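(* Let $\mathbb{K}$ be an arbitrary field of odd characteristic $p$, and let $\mathbb{F}_p$ be the prime field contained in $\mathbb{K}$. Let $P(t)\in\mathbb{K}[t]$ be any irreducible polynomial over $\mathbb{K}$. Let $r=v_2(p-1)\in\mathbb{Z}_{\geqslant 1}$ be the exponent of $2$ in $p-1$, let $$\mu^{*}_{2^r}=\left\{\zeta\in\mathbb{F}_p \mid \zeta^{2^{r-1}}=-1\right\},$$ and let $$\Lambda(t)=\sum_{k=0}^{\infty}\ \sum_{\zeta\in\mu^{*}_{2^r}}\frac{t^{2^k}}{t^{2^{k+1}}-\zeta}\in\mathbb{F}_p(\!(t^{-1})\!).$$ Then $$\inf_{Q(t)\in\mathbb{K}[t]\setminus\{0\}}\left|Q(t)\right|\cdot\left|Q(t)\right|_{P(t)}\cdot\left|\left\langle Q(t)\cdot\Lambda(P(t))\right\rangle\right|\geqslant 2^{-2^{r+1}\deg P(t)}.$$ Therefore, the formal Laurent series $\Lambda(P(t))\in\mathbb{K}(\!(t^{-1})\!)$ is a counterexample to the $P(t)$-adic Littlewood conjecture over $\mathbb{K}$.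
   Context: For a field $\mathbb{K}$, $\mathbb{K}(\!(t^{-1})\!)$ is the field of formal Laurent series in $t^{-1}$; it contains $\mathbb{K}(t)$ (rational functions are expanded in powers of $t^{-1}$) and is its completion with respect to the absolute value $|\cdot|$ defined next. For a nonzero $\Gamma(t)=\sum_{k\geqslant -k_0}a_kt^{-k}\in\mathbb{K}(\!(t^{-1})\!)$ with $a_{-k_0}\neq 0$, set $\deg\Gamma(t):=k_0\in\mathbb{Z}$, $|\Gamma(t)|:=2^{\deg\Gamma(t)}$, and let $\langle\Gamma(t)\rangle:=\sum_{k\geqslant 1}a_kt^{-k}$ be its fractional part. By convention $\deg 0=-\infty$ (so $|0|=0$) and $\langle 0\rangle=0$. For an irreducible $P(t)\in\mathbb{K}[t]$ and a nonzero $Q(t)\in\mathbb{K}[t]$, the $P(t)$-adic absolute value is $|Q(t)|_{P(t)}:=|P(t)|^{-v_{P(t)}(Q(t))}$, where $v_{P(t)}(Q(t))$ is the largest integer $v\geqslant 0$ with $P(t)^v\mid Q(t)$ (so $v_{P(t)}(P(t))=1$). The infinite sum defining $\Lambda(t)$ converges in $\mathbb{F}_p(\!(t^{-1})\!)$ for $|\cdot|$, since the $k$-th inner sum has absolute value at most $2^{-2^k}$. $\Lambda(P(t))$ denotes the element of $\mathbb{K}(\!(t^{-1})\!)$ obtained by substituting $P(t)$ for $t$ in the Laurent series $\Lambda(t)$ (well defined since $\deg P(t)\geqslant 1$). The $P(t)$-adic Littlewood conjecture over $\mathbb{K}$ (for an irreducible $P(t)\in\mathbb{K}[t]$) asserts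 that for every $\Gamma(t)\in\mathbb{K}(\!(t^{-1})\!)$ one has $\inf_{Q(t)\in\mathbb{K}[t]\setminus\{0\}}|Q(t)|\cdot|Q(t)|_{P(t)}\cdot|\langle Q(t)\Gamma(t)\rangle|=0$. A counterexample is a $\Gamma(t)\in\mathbb{K}(\!(t^{-1})\!)$ for which this infimum is not $0$. *)

theory Defs
  imports Complex_Main "HOL-Computational_Algebra.Computational_Algebra"
begin

text \<open>
  The field of formal Laurent series in \<open>1/t\<close> over \<open>K\<close> is the library type of formal Laurent
  series over \<open>K\<close>, its formal variable \<^term>\<open>fls_X\<close> playing the role of \<open>1/t\<close>. Hence
  \<open>t\<close> is \<^term>\<open>fls_X_inv\<close>, the coefficient of \<open>t\<^sup>-\<^sup>k\<close> in \<open>\<Gamma>\<close> is \<^term>\<open>fls_nth \<Gamma> k\<close>, and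
  the degree in \<open>t\<close> is minus the subdegree.
\<close>

definition laurent_deg :: "'a::zero fls \<Rightarrow> int" where
  "laurent_deg \<Gamma> = - fls_subdegree \<Gamma>" \<comment> \<open>only meaningful for nonzero \<open>\<Gamma>\<close>\<close>

definition laurent_abs :: "'a::zero fls \<Rightarrow> real" where
  "laurent_abs \<Gamma> = (if \<Gamma> = 0 then 0 else 2 powi laurent_deg \<Gamma>)"

text \<open>The library metric on Laurent series is the one induced by this absolute value.\<close>

lemma dist_fls_eq_laurent_abs:
  fixes \<Gamma> \<Delta> :: "'a::group_add fls"
  shows "dist \<Gamma> \<Delta> = laurent_abs (\<Gamma> - \<Delta>)"
  by (simp add: dist_fls_def laurent_abs_def laurent_deg_def power_int_def power_one_over
      inverse_eq_divide)

definition laurent_frac :: "'a::zero fls \<Rightarrow> 'a fls" where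
  "laurent_frac \<Gamma> = fps_to_fls (Abs_fps (\<lambda>k. if k \<ge> 1 then fls_nth \<Gamma> (int k) else 0))"

lemma fls_nth_laurent_frac:
  "fls_nth (laurent_frac \<Gamma>) n = (if n \<ge> 1 then fls_nth \<Gamma> n else 0)"
  by (auto simp: laurent_frac_def)

definition laurent_of_poly :: "'a::comm_ring_1 poly \<Rightarrow> 'a fls" where
  "laurent_of_poly Q = poly (map_poly fls_const Q) fls_X_inv"

lemma laurent_of_poly_0 [simp]: "laurent_of_poly 0 = 0"
  by (simp add: laurent_of_poly_def)

lemma laurent_of_poly_pCons:
  "laurent_of_poly (pCons a Q) = fls_const a + fls_X_inv * laurent_of_poly Q"
  by (simp add: laurent_of_poly_def map_poly_pCons)

lemma fls_nth_laurent_of_poly: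
  "fls_nth (laurent_of_poly Q) n = (if n \<le> 0 then coeff Q (nat (- n)) else 0)"
proof (induction Q arbitrary: n)
  case 0
  then show ?case by simp
next
  case (pCons a Q)
  consider m where "n = - int (Suc m)" | "n = 0" | "n > 0"
    using negD[of n] by (cases n "0::int" rule: linorder_cases) auto
  then show ?case
    by cases (auto simp: pCons laurent_of_poly_pCons fls_X_inv_times_conv_shift nat_add_distrib)
qed

text \<open>
  Substituting \<open>P(t)\<close> for \<open>t\<close> amounts to composing with the power series expansion of \<open>1/P(t)\<close>
  in the variable \<open>1/t\<close>; for \<open>deg P \<ge> 1\<close> that expansion is nonzero and has no constant term.
\<close>

definition laurent_subst :: "'a::field fls \<Rightarrow> 'a poly \<Rightarrow> 'a fls" where
  "laurent_subst \<Gamma> P = fls_compose_fps \<Gamma> (fls_regpart (inverse (laurent_of_poly P)))"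

lemma laurent_of_poly_const: "laurent_of_poly [:a:] = fls_const a"
  by (simp add: laurent_of_poly_pCons)

lemma laurent_of_poly_add:
  "laurent_of_poly (A + B) = laurent_of_poly A + laurent_of_poly B"
  by (rule fls_eqI) (simp add: fls_nth_laurent_of_poly)

lemma laurent_of_poly_smult: "laurent_of_poly (smult c B) = fls_const c * laurent_of_poly B"
  by (rule fls_eqI) (simp add: fls_nth_laurent_of_poly)

lemma laurent_of_poly_mult:
  "laurent_of_poly (A * B) = laurent_of_poly A * laurent_of_poly B"
proof (induction A)
  case 0
  then show ?case by simp
next
  case (pCons a A)
  then show ?case
    by (simp add: laurent_of_poly_add laurent_of_poly_smult laurent_of_poly_pCons algebra_simps)
qed

lemma laurent_deg_laurent_of_poly:
  assumes "Q \<noteq> 0"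
  shows "laurent_deg (laurent_of_poly Q) = int (degree Q)"
proof -
  have "fls_subdegree (laurent_of_poly Q) = - int (degree Q)"
    by (rule fls_subdegree_eqI)
       (use assms in \<open>auto simp: fls_nth_laurent_of_poly coeff_eq_0\<close>)
  then show ?thesis
    by (simp add: laurent_deg_def)
qed

lemma laurent_subst_laurent_of_poly:
  fixes P Q :: "'a::field poly"
  assumes "degree P \<ge> 1"
  shows "laurent_subst (laurent_of_poly Q) P = laurent_of_poly (pcompose Q P)"
proof -
  define G where "G = fls_regpart (inverse (laurent_of_poly P))"
  have P: "P \<noteq> 0"
    using assms by auto
  have sub: "fls_subdegree (laurent_of_poly P) = - int (degree P)"
    using laurent_deg_laurent_of_poly[OF P] by (simp add: laurent_deg_def)
  with assms have nz: "laurent_of_poly P \<noteq> 0"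
    by auto
  have isub: "fls_subdegree (inverse (laurent_of_poly P)) = int (degree P)"
    using sub by (simp add: fls_inverse_subdegree)
  have G: "fps_to_fls G = inverse (laurent_of_poly P)"
    unfolding G_def by (rule fls_regpart_to_fls_trivial) (use isub in linarith)
  have G0: "G \<noteq> 0"
    using G nz by auto
  have "fls_nth (inverse (laurent_of_poly P)) 0 = 0"
    by (rule fls_eq0_below_subdegree) (use isub assms in linarith)
  then have "fps_nth G 0 = 0"
    by (simp add: G_def)
  note G0 = G0 this
  have X: "fls_compose_fps fls_X_inv G = laurent_of_poly P"
    using G0 G by (simp add: fls_compose_fps_inverse flip: fls_inverse_X)
  have "fls_compose_fps (laurent_of_poly Q) G = laurent_of_poly (pcompose Q P)"
  proof (induction Q)
    case 0
    then show ?case by simp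
  next
    case (pCons a Q)
    then show ?case
      by (simp add: laurent_of_poly_pCons pcompose_pCons laurent_of_poly_const
          laurent_of_poly_add laurent_of_poly_mult fls_compose_fps_add
          fls_compose_fps_mult G0 X)
  qed
  then show ?thesis
    by (simp add: laurent_subst_def G_def)
qed

text \<open>
  The library constant \<^const>\<open>multiplicity\<close> is not available for polynomials over an arbitrary
  field (it needs a gcd structure on the coefficients). The maximum exists for
  irreducible \<open>P\<close> and nonzero \<open>Q\<close>.
\<close>

definition adic_val :: "'a::field poly \<Rightarrow> 'a poly \<Rightarrow> nat" where
  "adic_val P Q = (GREATEST v. P ^ v dvd Q)"

definition adic_abs :: "'a::field poly \<Rightarrow> 'a poly \<Rightarrow> real" where
  "adic_abs P Q = laurent_abs (laurent_of_poly P) powi (- int (adic_val P Q))"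

definition littlewood_inf :: "'a::field poly \<Rightarrow> 'a fls \<Rightarrow> real" where
  "littlewood_inf P \<Gamma> =
     (INF Q \<in> UNIV - {0}. laurent_abs (laurent_of_poly Q) * adic_abs P Q *
                            laurent_abs (laurent_frac (laurent_of_poly Q * \<Gamma>)))"

definition littlewood_conjecture :: "'a::field poly \<Rightarrow> bool" where
  "littlewood_conjecture P \<longleftrightarrow> (\<forall>\<Gamma>. littlewood_inf P \<Gamma> = 0)"

definition littlewood_counterexample :: "'a::field poly \<Rightarrow> 'a fls \<Rightarrow> bool" where
  "littlewood_counterexample P \<Gamma> \<longleftrightarrow> littlewood_inf P \<Gamma> \<noteq> 0"

lemma littlewood_conjecture_iff:
  "littlewood_conjecture P \<longleftrightarrow> (\<nexists>\<Gamma>. littlewood_counterexample P \<Gamma>)"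
  by (simp add: littlewood_conjecture_def littlewood_counterexample_def)

text \<open>
  In positive characteristic the image of the integers in a field is its prime field.
\<close>

definition mu_star :: "nat \<Rightarrow> 'a::field set" where
  "mu_star r = {\<zeta> \<in> range of_int. \<zeta> ^ (2 ^ (r - 1)) = -1}"

text \<open>
  The coefficients lie in the prime field, but the series is formed directly over \<open>K\<close>. The sum
  is that of the library topology, i.e. with respect to \<^const>\<open>laurent_abs\<close>.
\<close>

definition Lambda :: "nat \<Rightarrow> 'a::field fls" where
  "Lambda r = (\<Sum>k. \<Sum>\<zeta>\<in>mu_star r.
                 fls_X_inv ^ (2 ^ k) / (fls_X_inv ^ (2 ^ (k + 1)) - fls_const \<zeta>))"

lemma summable_fls_if_fls_nth_eq_0:
  fixes f :: "nat \<Rightarrow> 'a::ab_group_add fls"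
  assumes f: "\<And>k n. n \<le> int k \<Longrightarrow> fls_nth (f k) n = 0"
  shows "summable f"
proof -
  define S where "S = fps_to_fls (Abs_fps (\<lambda>n. \<Sum>k<n. fls_nth (f k) (int n)))"
  have nth_sum: "fls_nth (sum f A) n = (\<Sum>k\<in>A. fls_nth (f k) n)" for A n
    by (induction A rule: infinite_finite_induct) auto
  have agree: "fls_nth (sum f {..<N}) n = fls_nth S n" if "n \<le> int N" for N n
  proof (cases "n \<ge> 0")
    case True
    then have "(\<Sum>k<N. fls_nth (f k) n) = (\<Sum>k<nat n. fls_nth (f k) n)"
      using that f by (intro sum.mono_neutral_right) auto
    with True show ?thesis
      by (simp add: nth_sum S_def)
  next
    case False
    with f show ?thesis
      by (auto simp: nth_sum S_def intro!: sum.neutral)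
  qed
  have bound: "dist (sum f {..<N}) S \<le> (1/2) ^ N" for N
  proof (cases "sum f {..<N} = S")
    case False
    then have "fls_subdegree (sum f {..<N} - S) \<ge> int N"
      by (intro fls_subdegree_geI) (auto simp: agree)
    then have "inverse (2 ^ nat (fls_subdegree (sum f {..<N} - S))) \<le> inverse (2 ^ N :: real)"
      by (intro le_imp_inverse_le power_increasing) auto
    with False \<open>fls_subdegree (sum f {..<N} - S) \<ge> int N\<close> show ?thesis
      by (simp add: dist_fls_def power_one_over inverse_eq_divide)
  qed auto
  have lim: "(\<lambda>N. (1/2) ^ N :: real) \<longlonglongrightarrow> 0"
    by (rule LIMSEQ_power_zero) simp
  have "(\<lambda>N. dist (sum f {..<N}) S) \<longlonglongrightarrow> 0"
    by (rule tendsto_sandwich[OF always_eventually always_eventually tendsto_const lim])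
       (simp_all add: bound)
  then have "(\<lambda>N. sum f {..<N}) \<longlonglongrightarrow> S"
    by (subst tendsto_dist_iff)
  then show ?thesis
    unfolding summable_def sums_def by blast
qed

lemma summable_Lambda:
  "summable (\<lambda>k. \<Sum>\<zeta>\<in>mu_star r.
     fls_X_inv ^ (2 ^ k) / (fls_X_inv ^ (2 ^ (k + 1)) - fls_const (\<zeta> :: 'a::field)))"
proof (rule summable_fls_if_fls_nth_eq_0)
  fix k :: nat and n :: int
  assume n: "n \<le> int k"
  have "fls_nth (fls_X_inv ^ (2 ^ k) / (fls_X_inv ^ (2 ^ (k + 1)) - fls_const \<zeta>)) n = 0"
    for \<zeta> :: 'a
  proof (rule fls_eq0_below_subdegree)
    have *: "fls_subdegree (fls_X_inv ^ (2 * m) - fls_const \<zeta>) = - int (2 * m)" if "m > 0" for m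
      by (rule fls_subdegree_eqI) (use that in auto)
    from *[of "2 ^ k"]
    have sub: "fls_subdegree (fls_X_inv ^ (2 ^ (k + 1)) - fls_const \<zeta>) = - (2 * 2 ^ k)"
      by simp
    then have "fls_X_inv ^ (2 ^ (k + 1)) - fls_const \<zeta> \<noteq> 0"
      by force
    then have "fls_subdegree (fls_X_inv ^ (2 ^ k) / (fls_X_inv ^ (2 ^ (k + 1)) - fls_const \<zeta>))
                 = 2 ^ k"
      using sub by (simp add: fls_divide_subdegree)
    moreover have "int k < 2 ^ k"
      using of_nat_less_iff[of k "2 ^ k", where 'a = int] by simp
    ultimately show "n < fls_subdegree
        (fls_X_inv ^ (2 ^ k) / (fls_X_inv ^ (2 ^ (k + 1)) - fls_const \<zeta>))"
      using n by linarith
  qed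
  moreover have nth_sum: "fls_nth (sum g A) n = (\<Sum>\<zeta>\<in>A. fls_nth (g \<zeta>) n)"
    for g :: "'a \<Rightarrow> 'a fls" and A
    by (induction A rule: infinite_finite_induct) auto
  ultimately show "fls_nth (\<Sum>\<zeta>\<in>mu_star r.
      fls_X_inv ^ (2 ^ k) / (fls_X_inv ^ (2 ^ (k + 1)) - fls_const (\<zeta> :: 'a))) n = 0"
    by simp
qed

end

theory Submission
  imports Defs
begin

text \<open>
  Put \<open>N = 2\<^sup>r\<close> and \<open>R = (N/2) t\<^bsup>N-1\<^esup>/(t\<^sup>N + 1)\<close>. The \<open>N/2\<close> elements \<open>\<zeta>\<close> over which the inner sums
  run are all the roots of \<open>x\<^bsup>N/2\<^esup> = -1\<close>, so the inner sum for \<open>k = 0\<close> is a logarithmic derivative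
  and equals \<open>R\<close>. Hence \<open>\<Lambda>(t) = R(t) + \<Lambda>(t\<^sup>2)\<close> and \<open>\<Lambda>(t) - \<Lambda>(-t) = 2 R(t)\<close>, and the coefficients of
  \<open>\<Lambda>\<close> lie in the prime field.

  For \<open>P(t) = t\<close> the theorem says that \<open>deg(t\<^sup>n Q \<Lambda> - S) \<ge> -deg Q - 2N\<close> for all \<open>n\<close>, all \<open>Q \<noteq> 0\<close> and
  all polynomials \<open>S\<close> (\<open>Lambda_badly_approximable\<close>). This is proved by infinite descent on a sharper
  claim. Let \<open>m \<le> N\<close> be the number of \<open>N\<close>-th roots of unity at which \<open>Q\<close> does not vanish. Call
  \<open>S/(t\<^sup>n Q)\<close> a good approximation if \<open>deg(t\<^sup>n Q \<Lambda> - S) < -deg Q - 2m\<close>; the claim is that there is none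
  (\<open>no_approx\<close>).

  \<^item> Replacing \<open>t\<close> by \<open>-t\<close> gives a good approximation of \<open>\<Lambda>(t) - 2R(t)\<close>, and so, by subtraction, a
    rational function that is very close to \<open>2R\<close>. As \<open>Q(t)\<close> and \<open>Q(-t)\<close> have at least \<open>N - 2m\<close>
    common zeros, the degree of the common denominator is small enough to force equality
    (\<open>approx_identity\<close>).
  \<^item> The function \<open>R\<close> has poles at \<open>t\<^sup>2 = \<zeta>\<close>, and \<open>\<zeta>\<close> is not a square in the prime field because
    \<open>N\<close> is the exact power of \<open>2\<close> in \<open>p - 1\<close>. If \<open>Q\<close> has coefficients in the prime field, then
    \<open>t\<^sup>2 - \<zeta>\<close> is irreducible there and must divide \<open>Q\<close>. So \<open>t\<^sup>N + 1\<close> divides \<open>Q\<close>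
    (\<open>star_denominator\<close>).
  \<^item> For a reduced fraction the exact equality now forces \<open>n\<close> and \<open>Q\<close> to be even,
    and \<open>S/(t\<^sup>n Q) - R\<close> is a function \<open>S'/(t\<^bsup>n/2\<^esup> W)\<close> of \<open>t\<^sup>2\<close>. It approximates
    \<open>\<Lambda>(t\<^sup>2)\<close>. The passage from \<open>Q\<close> to \<open>W\<close> halves the degree and the order of the error, and it at
    least halves \<open>m\<close>, since \<open>W\<close> vanishes at every \<open>\<zeta>\<close> and squaring is two-to-one on the
    \<open>N\<close>-th roots of unity. Hence \<open>S'/(t\<^bsup>n/2\<^esup> W)\<close> is again a good approximation
    (\<open>approx_descent\<close>).
  \<^item> A good approximation that minimises \<open>n + 2 deg Q\<close> is reduced. By uniqueness of best
    approximations the Frobenius map then fixes its monic denominator, whose coefficients therefore lie in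
    the prime field (\<open>frob_fixed\<close>).

  For general \<open>P\<close> of degree \<open>d\<close>, write \<open>Q = P\<^sup>v \<Sum>\<^sub>i t\<^sup>i q\<^sub>i(P)\<close> with \<open>i < d\<close>. The degrees
  of the terms \<open>t\<^sup>i \<Gamma>\<^sub>i(P)\<close> of such a sum of Laurent series are distinct modulo \<open>d\<close>, so no cancellation
  takes place and the bound for \<open>P\<close> follows from the bounds for the \<open>t\<^sup>v q\<^sub>i\<close>
  (\<open>subst_Lambda_badly_approximable\<close>).
\<close>

section \<open>Orders of vanishing of Laurent series\<close>

text \<open>
  This is \<open>deg \<Gamma> < -k\<close>, in a form that includes \<open>\<Gamma> = 0\<close> without a separate case. The index \<open>k\<close> is
  an integer because multiplication by a polynomial lowers it.
\<close>

definition vanishes_upto :: "int \<Rightarrow> 'a::zero fls \<Rightarrow> bool" where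
  "vanishes_upto k \<Gamma> \<longleftrightarrow> (\<forall>i\<le>k. fls_nth \<Gamma> i = 0)"

lemma vanishes_upto_iff: "vanishes_upto k \<Gamma> \<longleftrightarrow> \<Gamma> = 0 \<or> k < fls_subdegree \<Gamma>"
  unfolding vanishes_upto_def
  by (metis fls_eq0_below_subdegree fls_zero_nth linorder_not_le nth_fls_subdegree_nonzero order.strict_trans1)

lemma vanishes_upto_0 [simp]: "vanishes_upto k 0"
  by (simp add: vanishes_upto_def)

lemma vanishes_upto_mono: "vanishes_upto k \<Gamma> \<Longrightarrow> l \<le> k \<Longrightarrow> vanishes_upto l \<Gamma>"
  by (auto simp: vanishes_upto_def)

lemma vanishes_upto_add:
  fixes \<Gamma> :: "'a::group_add fls"
  shows "vanishes_upto k \<Gamma> \<Longrightarrow> vanishes_upto k \<Delta> \<Longrightarrow> vanishes_upto k (\<Gamma> + \<Delta>)"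
  by (auto simp: vanishes_upto_def)

lemma vanishes_upto_diff:
  fixes \<Gamma> :: "'a::group_add fls"
  shows "vanishes_upto k \<Gamma> \<Longrightarrow> vanishes_upto k \<Delta> \<Longrightarrow> vanishes_upto k (\<Gamma> - \<Delta>)"
  by (auto simp: vanishes_upto_def)

lemma fls_nth_sum: "fls_nth (sum f A) n = (\<Sum>x\<in>A. fls_nth (f x) n)"
  by (induction A rule: infinite_finite_induct) auto

lemma vanishes_upto_sum:
  fixes f :: "'b \<Rightarrow> 'a::ab_group_add fls"
  shows "(\<And>x. x \<in> A \<Longrightarrow> vanishes_upto k (f x)) \<Longrightarrow> vanishes_upto k (sum f A)"
  by (simp add: vanishes_upto_def fls_nth_sum)

lemma vanishes_upto_all_imp_0: "(\<And>k. vanishes_upto (int k) \<Gamma>) \<Longrightarrow> \<Gamma> = 0"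
  by (rule fls_eqI) (metis vanishes_upto_def fls_zero_nth nat_0_le le_cases int_nat_eq order_trans)

lemma laurent_of_poly_1 [simp]: "laurent_of_poly 1 = 1"
  using laurent_of_poly_const[of 1] by (simp add: one_pCons)

lemma laurent_of_poly_diff:
  "laurent_of_poly (A - B) = laurent_of_poly A - laurent_of_poly B"
  by (rule fls_eqI) (simp add: fls_nth_laurent_of_poly)

lemma laurent_of_poly_power: "laurent_of_poly (A ^ n) = laurent_of_poly A ^ n"
  by (induction n) (simp_all add: laurent_of_poly_mult)

lemma laurent_of_poly_sum: "laurent_of_poly (sum f A) = (\<Sum>x\<in>A. laurent_of_poly (f x))"
  by (induction A rule: infinite_finite_induct) (simp_all add: laurent_of_poly_add)

lemma laurent_of_poly_monom: "laurent_of_poly (monom 1 n) = fls_X_inv ^ n"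
  by (induction n) (simp_all add: monom_0 monom_Suc laurent_of_poly_pCons one_pCons[symmetric])

lemma vanishes_upto_laurent_of_poly: "vanishes_upto 0 (laurent_of_poly A) \<longleftrightarrow> A = 0"
proof
  assume *: "vanishes_upto 0 (laurent_of_poly A)"
  have "coeff A n = 0" for n
    using *[unfolded vanishes_upto_def, rule_format, of "- int n"] 
    by (simp add: fls_nth_laurent_of_poly)
  then show "A = 0" by (simp add: poly_eqI)
qed simp

lemma laurent_of_poly_eq_0_iff [simp]: "laurent_of_poly A = 0 \<longleftrightarrow> A = 0"
  using vanishes_upto_laurent_of_poly[of A] by auto

lemma fls_subdegree_laurent_of_poly: "fls_subdegree (laurent_of_poly A) = - int (degree A)"
  using laurent_deg_laurent_of_poly[of A] by (cases "A = 0") (auto simp: laurent_deg_def)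

lemma vanishes_upto_mult_poly:
  fixes A :: "'a::field poly"
  assumes "A \<noteq> 0"
  shows "vanishes_upto k (laurent_of_poly A * \<Gamma>) \<longleftrightarrow> vanishes_upto (k + int (degree A)) \<Gamma>"
proof (cases "\<Gamma> = 0")
  case False
  then have "fls_subdegree (laurent_of_poly A * \<Gamma>) = fls_subdegree \<Gamma> - int (degree A)"
    using assms by (simp add: fls_subdegree_laurent_of_poly)
  with False assms show ?thesis
    by (auto simp: vanishes_upto_iff)
qed simp

lemma polynomial_part_exists:
  fixes \<Gamma> :: "'a::comm_ring_1 fls"
  shows "\<exists>A. vanishes_upto 0 (\<Gamma> - laurent_of_poly A)"
proof
  define A where "A = Abs_poly (\<lambda>n. fls_nth \<Gamma> (- int n))"
  have "coeff A n = fls_nth \<Gamma> (- int n)" for n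
  proof -
    have "\<forall>\<^sub>\<infinity>n. fls_nth \<Gamma> (- int n) = 0"
      unfolding MOST_nat by (rule exI[of _ "nat (- fls_subdegree \<Gamma>)"]) auto
    then show ?thesis by (simp add: A_def Abs_poly_inverse)
  qed
  then show "vanishes_upto 0 (\<Gamma> - laurent_of_poly A)"
    by (simp add: vanishes_upto_def fls_nth_laurent_of_poly)
qed

lemma laurent_frac_eqI:
  fixes \<Gamma> :: "'a::comm_ring_1 fls"
  assumes "vanishes_upto 0 (\<Gamma> - laurent_of_poly A)"
  shows "laurent_frac \<Gamma> = \<Gamma> - laurent_of_poly A"
  using assms
  by (intro fls_eqI) (auto simp: fls_nth_laurent_frac fls_nth_laurent_of_poly vanishes_upto_def)

text \<open>
  These are the conditions under which composition of Laurent series with the expansion of \<open>1/P\<close>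
  is a ring homomorphism.
\<close>

section \<open>Substitution of a polynomial into a Laurent series\<close>

lemma subst_series:
  fixes P :: "'a::field poly"
  assumes "degree P \<ge> 1"
  shows "subdegree (fls_regpart (inverse (laurent_of_poly P))) = degree P"
    and "fls_regpart (inverse (laurent_of_poly P)) \<noteq> 0"
    and "fps_nth (fls_regpart (inverse (laurent_of_poly P))) 0 = 0"
proof -
  let ?G = "fls_regpart (inverse (laurent_of_poly P))"
  have s: "fls_subdegree (inverse (laurent_of_poly P)) = int (degree P)"
    by (simp add: fls_inverse_subdegree fls_subdegree_laurent_of_poly)
  have G: "fps_to_fls ?G = inverse (laurent_of_poly P)"
    by (rule fls_regpart_to_fls_trivial) (unfold s, simp)
  then show 1: "subdegree ?G = degree P"
    using s by (metis fls_subdegree_fls_to_fps of_nat_eq_iff)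
  show "?G \<noteq> 0" using 1 assms by auto
  show "fps_nth ?G 0 = 0" using 1 assms by (intro nth_less_subdegree_zero) auto
qed

context
  fixes P :: "'a::field poly"
  assumes P: "degree P \<ge> 1"
begin

lemma laurent_subst_0 [simp]: "laurent_subst 0 P = 0"
  by (simp add: laurent_subst_def)

lemma laurent_subst_add: "laurent_subst (\<Gamma> + \<Delta>) P = laurent_subst \<Gamma> P + laurent_subst \<Delta> P"
  unfolding laurent_subst_def by (intro fls_compose_fps_add subst_series P)

lemma laurent_subst_diff: "laurent_subst (\<Gamma> - \<Delta>) P = laurent_subst \<Gamma> P - laurent_subst \<Delta> P"
  unfolding laurent_subst_def by (intro fls_compose_fps_diff subst_series P)

lemma laurent_subst_mult: "laurent_subst (\<Gamma> * \<Delta>) P = laurent_subst \<Gamma> P * laurent_subst \<Delta> P"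
  unfolding laurent_subst_def by (intro fls_compose_fps_mult subst_series P)

lemma laurent_subst_divide: "laurent_subst (\<Gamma> / \<Delta>) P = laurent_subst \<Gamma> P / laurent_subst \<Delta> P"
  unfolding laurent_subst_def by (intro fls_compose_fps_divide subst_series P)

lemma laurent_subst_sum: "laurent_subst (sum f A) P = (\<Sum>x\<in>A. laurent_subst (f x) P)"
  by (induction A rule: infinite_finite_induct) (simp_all add: laurent_subst_add)

lemma laurent_subst_const [simp]: "laurent_subst (fls_const c) P = fls_const c"
  by (simp add: laurent_subst_def)

lemma laurent_subst_1 [simp]: "laurent_subst 1 P = 1"
  by (simp add: laurent_subst_def)

lemma laurent_subst_power: "laurent_subst (\<Gamma> ^ n) P = laurent_subst \<Gamma> P ^ n"
  by (induction n) (simp_all add: laurent_subst_mult)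

lemma laurent_subst_X_inv: "laurent_subst fls_X_inv P = laurent_of_poly P"
  using laurent_subst_laurent_of_poly[OF P, of "[:0, 1:]"]
  by (simp add: laurent_of_poly_pCons pcompose_pCons)

lemma laurent_subst_eq_0_iff: "laurent_subst \<Gamma> P = 0 \<longleftrightarrow> \<Gamma> = 0"
  unfolding laurent_subst_def by (intro fls_compose_fps_eq_0_iff subst_series P)

lemma fls_subdegree_laurent_subst:
  "fls_subdegree (laurent_subst \<Gamma> P) = int (degree P) * fls_subdegree \<Gamma>"
  by (simp only: laurent_subst_def subdegree_fls_compose_fps[OF subst_series(3)[OF P]]
      subst_series(1)[OF P] mult.commute)

text \<open>
  Substitution multiplies every degree by \<open>deg P\<close>, so orders of vanishing can be read off in both
  directions. The descent uses this with \<open>P = t\<^sup>2\<close>, the Frobenius argument with \<open>P = t\<^sup>p\<close>.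
\<close>

lemma vanishes_upto_laurent_subst:
  "vanishes_upto (int (degree P) * k) (laurent_subst \<Gamma> P) \<longleftrightarrow> vanishes_upto k \<Gamma>"
  using P by (auto simp: vanishes_upto_iff laurent_subst_eq_0_iff fls_subdegree_laurent_subst)

lemma vanishes_upto_laurent_substI:
  "vanishes_upto (int k) \<Gamma> \<Longrightarrow> vanishes_upto (int k) (laurent_subst \<Gamma> P)"
proof -
  assume "vanishes_upto (int k) \<Gamma>"
  then have "vanishes_upto (int (degree P) * int k) (laurent_subst \<Gamma> P)"
    by (simp add: vanishes_upto_laurent_subst)
  moreover have "int k \<le> int (degree P) * int k"
    using P by (metis int_ops(7) mult_le_mono1 nat_mult_1 of_nat_mono)
  ultimately show ?thesis by (rule vanishes_upto_mono)
qed

end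

lemma vanishes_upto_power:
  fixes \<Gamma> :: "'a::field fls"
  assumes "n > 0"
  shows "vanishes_upto (int n * k) (\<Gamma> ^ n) \<longleftrightarrow> vanishes_upto k \<Gamma>"
  using assms by (auto simp: vanishes_upto_iff fls_subdegree_pow)

section \<open>Roots of unity in the prime field\<close>

text \<open>
  If a product has as many roots as its degree permits, then so has each factor: the other factor
  accounts for no more roots than its degree.
\<close>

lemma card_roots_of_factor:
  fixes A B :: "'a::idom poly"
  assumes "A * B \<noteq> 0" and "finite S" and full: "degree (A * B) \<le> card {x\<in>S. poly (A * B) x = 0}"
  shows "card {x\<in>S. poly A x = 0} = degree A"
proof (rule antisym)
  have "A \<noteq> 0" "B \<noteq> 0"
    using assms(1) by auto
  have bound: "card {x\<in>S. poly C x = 0} \<le> degree C" if "C \<noteq> 0" for C :: "'a poly"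
    using that by (intro order.trans[OF card_mono card_poly_roots_bound[of C]]) (auto simp: poly_roots_finite)
  show "card {x\<in>S. poly A x = 0} \<le> degree A"
    by (rule bound) fact
  have "degree A + degree B \<le> card ({x\<in>S. poly A x = 0} \<union> {x\<in>S. poly B x = 0})"
    using full \<open>A \<noteq> 0\<close> \<open>B \<noteq> 0\<close> by (simp add: degree_mult_eq conj_disj_distribL Collect_disj_eq)
  also have "\<dots> \<le> card {x\<in>S. poly A x = 0} + card {x\<in>S. poly B x = 0}"
    by (rule card_Un_le)
  also have "card {x\<in>S. poly B x = 0} \<le> degree B"
    by (rule bound) fact
  finally show "degree A \<le> card {x\<in>S. poly A x = 0}"
    by simp
qed

lemma degree_monom_one_add:
  assumes "n > 0"
  shows "degree (monom 1 n + [:c:]) = n" and "monom 1 n + [:c:] \<noteq> (0 :: 'a::comm_ring_1 poly)"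
proof -
  show "degree (monom 1 n + [:c:]) = n"
    using assms by (subst degree_add_eq_left) (simp_all add: degree_monom_eq)
  then show "monom 1 n + [:c:] \<noteq> 0"
    using assms by auto
qed

lemma prod_roots_of_minus_one:
  fixes S :: "'a::idom set"
  assumes "finite S" "card S = m" "m > 0" and "\<And>z. z \<in> S \<Longrightarrow> z ^ m = -1"
  shows "(\<Prod>z\<in>S. [:-z, 1:]) = monom 1 m + [:1:]"
proof (rule poly_eqI_degree_lead_coeff)
  have deg: "degree (\<Prod>z\<in>S. [:-z, 1:]) = m"
    using assms by (simp add: degree_prod_eq_sum_degree)
  have lc: "lead_coeff (\<Prod>z\<in>S. [:-z, 1:]) = 1"
    by (simp add: lead_coeff_prod)
  show "degree (\<Prod>z\<in>S. [:-z, 1:]) \<le> m" "degree (monom 1 m + [:1:] :: 'a poly) \<le> m"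
    using deg assms by (simp_all add: degree_monom_one_add)
  show "coeff (\<Prod>z\<in>S. [:-z, 1:]) m = coeff (monom 1 m + [:1:]) m"
    using lc deg assms by (simp add: coeff_pCons split: nat.split)
  show "card S \<ge> m"
    using assms by simp
  show "poly (\<Prod>z\<in>S. [:-z, 1:]) z = poly (monom 1 m + [:1:]) z" if "z \<in> S" for z
    using that assms by (auto simp: poly_prod poly_monom)
qed

text \<open>
  This is the logarithmic derivative of \<open>y\<^sup>m + 1 = \<Prod>(y - z)\<close>.
\<close>

lemma sum_inverse_diff_roots_of_minus_one:
  fixes S :: "'a::field set"
  assumes "finite S" "card S = m" "m > 0" and "\<And>z. z \<in> S \<Longrightarrow> z ^ m = -1" and "y \<notin> S"
  shows "(\<Sum>z\<in>S. 1 / (y - z)) = of_nat m * y ^ (m - 1) / (y ^ m + 1)"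
proof -
  let ?D = "\<Prod>z\<in>S. [:-z, 1:]"
  have D: "?D = monom 1 m + [:1:]"
    using assms by (intro prod_roots_of_minus_one) auto
  have nz: "(\<Prod>z\<in>S. y - z) \<noteq> 0"
    using assms by auto
  have 1: "(\<Prod>z\<in>S. y - z) = y ^ m + 1"
    using arg_cong[OF D, of "\<lambda>D. poly D y"] by (simp add: poly_prod poly_monom)
  have "of_nat m * y ^ (m - 1) = poly (pderiv ?D) y"
    by (simp add: D pderiv_add pderiv_monom poly_monom pderiv_pCons)
  also have "\<dots> = (\<Sum>z\<in>S. \<Prod>w\<in>S - {z}. y - w)"
    by (simp add: pderiv_prod poly_sum poly_prod pderiv_pCons)
  also have "\<dots> = (\<Sum>z\<in>S. (\<Prod>w\<in>S. y - w) * (1 / (y - z)))"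
  proof (rule sum.cong)
    fix z assume "z \<in> S"
    with assms have "(\<Prod>w\<in>S. y - w) = (y - z) * (\<Prod>w\<in>S - {z}. y - w)" "y - z \<noteq> 0"
      by (auto simp: prod.remove)
    then show "(\<Prod>w\<in>S - {z}. y - w) = (\<Prod>w\<in>S. y - w) * (1 / (y - z))"
      by simp
  qed simp
  also have "\<dots> = (y ^ m + 1) * (\<Sum>z\<in>S. 1 / (y - z))"
    by (simp add: 1 sum_distrib_left)
  finally show ?thesis
    using nz by (simp add: 1)
qed

text \<open>
  The locale depends on the field only through its type, which the argument \<open>ty\<close> carries, since
  \<open>p\<close>, \<open>r\<close> and \<open>N\<close> do not mention it.
\<close>

locale odd_characteristic =
  fixes ty :: "'a::field itself" and p r N :: nat
  assumes p_CHAR: "p = CHAR('a)" and odd_p: "odd p"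
    and r_def: "r = multiplicity 2 (p - 1)" and N_def: "N = 2 ^ r"
begin

lemma prime_p: "prime p"
  using odd_p prime_CHAR_semidom[where 'a = 'a] by (simp add: p_CHAR odd_pos)

lemma p_gt_2: "p > 2"
  using prime_p odd_p prime_ge_2_nat[of p] by (cases "p = 2") auto

lemma of_nat_p_neq_0: "0 < k \<Longrightarrow> k < p \<Longrightarrow> of_nat k \<noteq> (0 :: 'a)"
  by (simp add: of_nat_eq_0_iff_char_dvd p_CHAR nat_dvd_not_less)

lemma two_neq_0: "(2 :: 'a) \<noteq> 0"
  using of_nat_p_neq_0[of 2] p_gt_2 by simp

lemma one_neq_minus_one: "(1 :: 'a) \<noteq> -1"
  using two_neq_0 by (metis add.inverse_inverse add_eq_0_iff one_add_one)

lemma r_pos: "r > 0"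
  using odd_p p_gt_2 by (auto simp: r_def multiplicity_gt_zero_iff)

definition M :: nat where "M = 2 ^ (r - 1)"

lemma M_pos: "M > 0"
  by (simp add: M_def)

lemma N_eq: "N = 2 * M"
  using r_pos by (simp add: N_def M_def flip: power_Suc)

lemma p_minus_1: obtains m where "p - 1 = N * m" "odd m"
proof -
  obtain m where "p - 1 = 2 ^ r * m" "\<not> 2 dvd m"
    unfolding r_def by (rule multiplicity_decompose'[of "p - 1" 2]) (use p_gt_2 in auto)
  then show ?thesis using that by (simp add: N_def)
qed

lemma of_nat_M_neq_0: "of_nat M \<noteq> (0 :: 'a)"
  using two_neq_0 by (simp add: M_def)

lemma fermat: "x \<in> range of_int \<Longrightarrow> x ^ p = (x :: 'a)"
proof -
  have nat: "of_nat k ^ p = (of_nat k :: 'a)" for k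
    by (induction k) (use prime_p prime_gt_0_nat[OF prime_p] in \<open>simp_all add: freshmans_dream p_CHAR power_0_left\<close>)
  assume "x \<in> range of_int"
  then obtain k where "x = of_int k" by auto
  then show ?thesis
    using nat[of "nat \<bar>k\<bar>"] odd_p by (cases "k \<ge> 0") (auto simp: of_nat_nat)
qed

lemma finite_range_of_int: "finite (range (of_int :: int \<Rightarrow> 'a))"
proof -
  have "range of_int \<subseteq> {x :: 'a. poly (monom 1 p - [:0, 1:]) x = 0}"
    by (auto simp: poly_monom fermat)
  moreover have "finite {x :: 'a. poly (monom 1 p - [:0, 1:]) x = 0}"
    using p_gt_2 by (intro poly_roots_finite) (auto simp: poly_eq_iff coeff_pCons split: nat.split
      intro!: exI[of _ p])
  ultimately show ?thesis by (rule finite_subset)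
qed

text \<open>
  The polynomial \<open>x\<^bsup>p-1\<^esup> - 1\<close> splits over the prime field, so every factor of it does.
\<close>

lemma card_roots_Fp:
  fixes A B :: "'a poly"
  assumes "A * B = monom 1 (p - 1) + [:-1:]"
  shows "card {x \<in> range of_int. poly A x = 0} = degree A"
proof (rule card_roots_of_factor)
  show "A * B \<noteq> 0"
    using p_gt_2 unfolding assms by (intro degree_monom_one_add) auto
  have "inj_on (of_nat :: nat \<Rightarrow> 'a) {1..<p}"
  proof (rule linorder_inj_onI)
    fix i j assume "i < j" "i \<in> {1..<p}" "j \<in> {1..<p}"
    then have "of_nat (j - i) \<noteq> (0 :: 'a)"
      by (intro of_nat_p_neq_0) auto
    with \<open>i < j\<close> show "of_nat i \<noteq> (of_nat j :: 'a)"
      by (auto simp: of_nat_diff)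
  qed auto
  then have "p - 1 = card ((of_nat :: nat \<Rightarrow> 'a) ` {1..<p})"
    by (simp add: card_image)
  also have "\<dots> \<le> card {x :: 'a \<in> range of_int. poly (A * B) x = 0}"
  proof (rule card_mono)
    have "(of_nat k :: 'a) ^ (p - 1) = 1" if "k \<in> {1..<p}" for k
    proof -
      have "(of_nat k :: 'a) ^ (p - 1) * of_nat k = of_nat k"
        using fermat[of "of_nat k"] p_gt_2
        by (metis Suc_diff_1 gr0I not_less_zero of_int_of_nat_eq power_Suc2 rangeI)
      then show ?thesis
        using of_nat_p_neq_0[of k] that by auto
    qed
    moreover have "of_nat k \<in> range (of_int :: int \<Rightarrow> 'a)" for k
      by (metis of_int_of_nat_eq rangeI)
    ultimately show "of_nat ` {1..<p} \<subseteq> {x :: 'a \<in> range of_int. poly (A * B) x = 0}"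
      unfolding assms by (auto simp: poly_monom)
  qed (simp add: finite_range_of_int)
  finally show "degree (A * B) \<le> card {x :: 'a \<in> range of_int. poly (A * B) x = 0}"
    unfolding assms using p_gt_2 by (simp add: degree_monom_one_add)
qed (rule finite_range_of_int)

text \<open>
  Apply the preceding lemma to the factors of \<open>x\<^sup>N - 1 = (x\<^sup>M - 1)(x\<^sup>M + 1)\<close>, which divides \<open>x\<^bsup>p-1\<^esup> - 1\<close>.
  As the prime field already contains \<open>M\<close> solutions of \<open>x\<^sup>M = -1\<close>, the whole field contains no others,
  and membership in the prime field can be dropped from the description of \<open>mu_star r\<close>.
\<close>

lemma card_mu:
  "card {x :: 'a. x ^ M = 1} = M" (is ?A) and card_mu_star: "card (mu_star r :: 'a set) = M" (is ?B)
  and mu_star_eq: "mu_star r = {x :: 'a. x ^ M = -1}" (is ?C)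
proof -
  obtain m where m: "p - 1 = N * m" "odd m" by (rule p_minus_1)
  have "[:-1:] = (-1 :: 'a poly)"
    by (simp add: one_pCons)
  moreover have "monom 1 N - 1 dvd (monom 1 N ^ m - 1 ^ m :: 'a poly)"
    using power_diff_sumr2[of "monom 1 N :: 'a poly" m 1] by (metis dvd_triv_left)
  ultimately have "monom 1 N + [:-1:] dvd (monom 1 (p - 1) + [:-1:] :: 'a poly)"
    unfolding m(1) by (simp add: monom_power)
  then obtain B :: "'a poly" where B: "(monom 1 N + [:-1:]) * B = monom 1 (p - 1) + [:-1:]"
    by (metis dvdE)
  have fac: "(monom 1 M + [:-1:]) * (monom 1 M + [:1:]) = (monom 1 N + [:-1:] :: 'a poly)"
    proof -
    have "[:-1:] = (-1 :: 'a poly)" "[:1:] = (1 :: 'a poly)"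
      by (simp_all add: one_pCons)
    moreover have "monom 1 N = (monom 1 M * monom 1 M :: 'a poly)"
      by (simp add: N_eq mult_2 mult_monom)
    moreover have "(x + -1) * (x + 1) = x * x + -1" for x :: "'a poly"
      by (simp add: algebra_simps)
    ultimately show ?thesis by metis
  qed
  have 1: "card {x :: 'a \<in> range of_int. poly (monom 1 M + [:-1:]) x = 0} = M"
    by (subst card_roots_Fp[where B = "(monom 1 M + [:1:]) * B"])
      (use B fac M_pos in \<open>simp_all only: mult.assoc[symmetric] degree_monom_one_add\<close>)
  have 2: "card {x :: 'a \<in> range of_int. poly (monom 1 M + [:1:]) x = 0} = M"
    by (subst card_roots_Fp[where B = "(monom 1 M + [:-1:]) * B"])
      (use B fac M_pos in \<open>simp_all only: mult.assoc[symmetric] mult.commute[of "monom 1 M + [:1:]"] degree_monom_one_add\<close>)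
  have all: "{x :: 'a \<in> range of_int. poly (monom 1 M + [:c:]) x = 0} = {x. x ^ M = - c}"
    if "card {x :: 'a \<in> range of_int. poly (monom 1 M + [:c:]) x = 0} = M" for c
  proof -
    have eq: "{x. poly (monom 1 M + [:c:]) x = 0} = {x. x ^ M = - c}"
      by (auto simp: poly_monom eq_neg_iff_add_eq_0)
    have nz: "monom 1 M + [:c:] \<noteq> 0"
      using M_pos by (rule degree_monom_one_add)
    have "{x :: 'a \<in> range of_int. poly (monom 1 M + [:c:]) x = 0} = {x. poly (monom 1 M + [:c:]) x = 0}"
    proof (rule card_seteq)
      show "card {x. poly (monom 1 M + [:c:]) x = 0}
        \<le> card {x :: 'a \<in> range of_int. poly (monom 1 M + [:c:]) x = 0}"
        unfolding that using card_poly_roots_bound[OF nz] M_pos by (simp add: degree_monom_one_add)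
    qed (use poly_roots_finite[OF nz] in auto)
    with eq show ?thesis by simp
  qed
  show ?A using 1 all[OF 1] by simp
  have "mu_star r = {x :: 'a \<in> range of_int. poly (monom 1 M + [:1:]) x = 0}"
    by (auto simp: mu_star_def M_def poly_monom eq_neg_iff_add_eq_0)
  with 2 all[OF 2] show ?B ?C by simp_all
qed

lemma finite_mu_star: "finite (mu_star r :: 'a set)"
  using card_mu_star M_pos by (metis card.infinite less_irrefl)

lemma mu_split: "{x :: 'a. x ^ N = 1} = {x. x ^ M = 1} \<union> mu_star r"
  and mu_disjoint: "{x :: 'a. x ^ M = 1} \<inter> mu_star r = {}"
  using one_neq_minus_one
  by (auto simp: mu_star_eq N_eq mult.commute[of 2] power_mult power2_eq_1_iff)

lemma card_mu_N: "card {x :: 'a. x ^ N = 1} = N"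
  unfolding mu_split using mu_disjoint card_mu card_mu_star finite_mu_star M_pos
  by (subst card_Un_disjoint) (auto simp: N_eq intro: card_ge_0_finite)

lemma finite_mu_N: "finite {x :: 'a. x ^ N = 1}"
  using card_mu_N M_pos N_eq by (intro card_ge_0_finite) auto

lemma mu_N_Fp: "x ^ N = 1 \<Longrightarrow> x ^ p = (x :: 'a)"
proof -
  assume x: "x ^ N = 1"
  obtain m where m: "p - 1 = N * m" "odd m" by (rule p_minus_1)
  have "x ^ p = x ^ (p - 1) * x"
    using p_gt_2 by (metis Suc_diff_1 gr0I not_less_zero power_Suc2)
  then show ?thesis by (simp only: m power_mult x power_one mult_1)
qed

text \<open>
  If \<open>c\<^sup>2 = \<zeta>\<close> with \<open>c\<close> in the prime field, then \<open>1 = c\<^bsup>p-1\<^esup> = \<zeta>\<^bsup>(p-1)/2\<^esup>\<close>, but \<open>(p-1)/2\<close> is an odd multiple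
  of \<open>M\<close> and \<open>\<zeta>\<^sup>M = -1\<close>. Membership in the prime field is expressed by invariance under the
  Frobenius map.
\<close>

lemma mu_star_nonsquare:
  fixes a b \<zeta> :: 'a
  assumes "a ^ p = a" "b ^ p = b" and \<zeta>: "\<zeta> \<in> mu_star r" and eq: "a\<^sup>2 = \<zeta> * b\<^sup>2"
  shows "a = 0" and "b = 0"
proof -
  obtain m where m: "p - 1 = N * m" "odd m" by (rule p_minus_1)
  show "b = 0"
  proof (rule ccontr)
    assume b: "b \<noteq> 0"
    define c where "c = a / b"
    have c2: "c\<^sup>2 = \<zeta>"
      using eq b by (simp add: c_def power_divide)
    have "\<zeta> \<noteq> 0"
      using \<zeta> M_pos by (auto simp: mu_star_eq power_0_left)
    then have "c \<noteq> 0" using c2 by auto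
    moreover have "c ^ (p - 1) * c = c"
      using assms p_gt_2 unfolding c_def power_divide 
      by (metis Suc_diff_1 gr0I not_less_zero power_Suc2 power_divide)
    ultimately have "c ^ (p - 1) = 1"
      by simp
    moreover have "c ^ (p - 1) = ((c\<^sup>2) ^ M) ^ m"
      unfolding m(1) by (simp add: N_eq power_mult[symmetric])
    moreover have "\<dots> = -1"
      using \<zeta> m by (simp add: c2 mu_star_eq)
    ultimately show False
      using one_neq_minus_one by simp
  qed
  with eq show "a = 0" by simp
qed

definition star_poly :: "'a poly" where "star_poly = (\<Prod>\<zeta>\<in>mu_star r. [:-\<zeta>, 1:])"

lemma star_poly_eq: "star_poly = monom 1 M + [:1:]"
  unfolding star_poly_def
  by (rule prod_roots_of_minus_one) (use card_mu_star finite_mu_star M_pos in \<open>auto simp: mu_star_eq\<close>)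

end

section \<open>Functional equations of the series\<close>

lemma vanishes_upto_if_laurent_abs_less:
  assumes "laurent_abs \<Gamma> < 2 powi (- int k)"
  shows "vanishes_upto (int k) \<Gamma>"
proof (cases "\<Gamma> = 0")
  case False
  then have "(2 :: real) powi (- fls_subdegree \<Gamma>) < 2 powi (- int k)"
    using assms by (simp add: laurent_abs_def laurent_deg_def)
  then have "- fls_subdegree \<Gamma> < - int k"
    using power_int_increasing[of "- int k" "- fls_subdegree \<Gamma>" "2 :: real"] by force
  then show ?thesis by (simp add: vanishes_upto_iff)
qed simp

lemma vanishes_upto_suminf_tail:
  fixes f :: "nat \<Rightarrow> 'a::ab_group_add fls"
  assumes f: "\<And>k. vanishes_upto (int k) (f k)"
  shows "vanishes_upto (int n) (suminf f - (\<Sum>k<n. f k))"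
proof -
  have "summable f"
    using f by (intro summable_fls_if_fls_nth_eq_0) (auto simp: vanishes_upto_def)
  then have lim: "(\<lambda>m. \<Sum>k<m. f k) \<longlonglongrightarrow> suminf f"
    by (simp add: sums_def[symmetric] summable_sums)
  obtain m0 where m0: "\<And>m. m \<ge> m0 \<Longrightarrow> dist (\<Sum>k<m. f k) (suminf f) < 2 powi (- int n)"
    using metric_LIMSEQ_D[OF lim, of "2 powi (- int n)"] by auto
  define m where "m = max m0 n"
  have "vanishes_upto (int n) (suminf f - (\<Sum>k<m. f k))"
    using m0[of m] by (intro vanishes_upto_if_laurent_abs_less)
      (simp add: m_def flip: dist_fls_eq_laurent_abs, simp add: dist_commute)
  moreover have "vanishes_upto (int n) (\<Sum>k=n..<m. f k)"
    by (rule vanishes_upto_sum, rule vanishes_upto_mono[OF f]) simp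
  ultimately have "vanishes_upto (int n) ((suminf f - (\<Sum>k<m. f k)) + (\<Sum>k=n..<m. f k))"
    by (rule vanishes_upto_add)
  moreover have "(\<Sum>k<m. f k) = (\<Sum>k<n. f k) + (\<Sum>k=n..<m. f k)"
    by (simp add: m_def lessThan_atLeast0 sum.atLeastLessThan_concat)
  ultimately show ?thesis by (simp add: algebra_simps)
qed

lemma inj_fls_const: "inj (fls_const :: 'a::zero \<Rightarrow> 'a fls)"
  by (rule injI) (metis fls_const_nth)

context odd_characteristic
begin

text \<open>
  The closed form of the \<open>k\<close>-th inner sum of \<open>Lambda r\<close>.
\<close>

definition R :: "nat \<Rightarrow> 'a fls" where
  "R k = of_nat M * (fls_X_inv ^ 2 ^ k) ^ (N - 1) / ((fls_X_inv ^ 2 ^ k) ^ N + 1)"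

lemma Lambda_summand:
  "(\<Sum>\<zeta>\<in>mu_star r. fls_X_inv ^ (2 ^ k) / (fls_X_inv ^ (2 ^ (k + 1)) - fls_const \<zeta>)) = R k"
proof -
  define X :: "'a fls" where "X = fls_X_inv ^ 2 ^ k"
  have "fls_subdegree (X\<^sup>2) \<noteq> fls_subdegree (fls_const c)" for c :: 'a
    by (simp add: X_def power_mult[symmetric])
  then have "X\<^sup>2 \<noteq> fls_const c" for c
    by metis
  have "(\<Sum>\<zeta>\<in>mu_star r. X / (X\<^sup>2 - fls_const \<zeta>)) = X * (\<Sum>z\<in>fls_const ` mu_star r. 1 / (X\<^sup>2 - z))"
    using inj_fls_const by (subst sum.reindex) (auto simp: sum_distrib_left intro: inj_on_subset)
  also have "(\<Sum>z\<in>fls_const ` mu_star r. 1 / (X\<^sup>2 - z)) = of_nat M * (X\<^sup>2) ^ (M - 1) / ((X\<^sup>2) ^ M + 1)"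
  proof (rule sum_inverse_diff_roots_of_minus_one)
    show "card (fls_const ` mu_star r :: 'a fls set) = M"
      by (subst card_image) (auto simp: card_mu_star intro: inj_on_subset[OF inj_fls_const])
    show "z ^ M = -1" if "z \<in> fls_const ` mu_star r" for z :: "'a fls"
    proof -
      obtain x where "z = fls_const x" "x ^ M = -1"
        using \<open>z \<in> _\<close> by (auto simp: mu_star_eq)
      then show ?thesis
        by (metis fls_const_power fls_const_uminus fls_const_1)
    qed
    show "X\<^sup>2 \<notin> fls_const ` mu_star r"
      using \<open>\<And>c. X\<^sup>2 \<noteq> fls_const c\<close> by auto
  qed (simp_all add: finite_mu_star M_pos)
  also have "X * \<dots> = of_nat M * X ^ (N - 1) / (X ^ N + 1)"
  proof -
    have "X * (X\<^sup>2) ^ (M - 1) = X ^ (N - 1)"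
      using M_pos by (simp add: N_eq power_mult[symmetric] flip: power_Suc) (simp add: Suc_diff_Suc numeral_eq_Suc algebra_simps)
    moreover have "(X\<^sup>2) ^ M = X ^ N"
      by (simp add: N_eq power_mult)
    ultimately show ?thesis
      by (metis mult.left_commute times_divide_eq_right)
  qed
  finally show ?thesis
    by (simp add: R_def X_def power_mult[symmetric] mult.commute)
qed

abbreviation \<Lambda> :: "'a fls" where "\<Lambda> \<equiv> Lambda r"

lemma Lambda_eq: "\<Lambda> = suminf R"
  unfolding Lambda_def by (simp only: Lambda_summand)

lemma denominator_subdegree: "n > 0 \<Longrightarrow> fls_subdegree (fls_X_inv ^ n + 1 :: 'a fls) = - int n"
  by (rule fls_subdegree_eqI) auto

lemma denominator_neq_0: "n > 0 \<Longrightarrow> (fls_X_inv ^ n + 1 :: 'a fls) \<noteq> 0"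
  using denominator_subdegree[of n] by force

lemma vanishes_upto_R: "vanishes_upto (int k) (R k)"
proof -
  have "int k < 2 ^ k"
    using of_nat_less_iff[of k "2 ^ k", where 'a = int] by simp
  have nz: "(fls_X_inv ^ 2 ^ k) ^ N + 1 \<noteq> (0 :: 'a fls)"
    using denominator_neq_0[of "2 ^ k * N"] by (simp add: power_mult N_def)
  have "fls_subdegree ((fls_X_inv ^ 2 ^ k) ^ N + 1 :: 'a fls) = - int (2 ^ k * N)"
    using denominator_subdegree[of "2 ^ k * N"] by (simp add: power_mult N_def)
  moreover have "(of_nat M :: 'a fls) \<noteq> 0"
    using of_nat_M_neq_0 by (simp add: fls_of_nat)
  ultimately have "fls_subdegree (R k) = 2 ^ k"
    using nz M_pos unfolding R_def
    by (simp add: fls_divide_subdegree fls_subdegree_pow N_eq of_nat_diff algebra_simps)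
  with \<open>int k < 2 ^ k\<close> show ?thesis
    by (simp add: vanishes_upto_iff)
qed

lemma Lambda_approx: "vanishes_upto (int n) (\<Lambda> - (\<Sum>k<n. R k))"
  unfolding Lambda_eq by (intro vanishes_upto_suminf_tail vanishes_upto_R)

text \<open>
  The functional equations are checked on the terms \<open>R k\<close> and pass to their sum, which is
  characterised by agreeing with the \<open>n\<close>-th partial sum up to order \<open>n\<close> for every \<open>n\<close>.
\<close>

lemma Lambda_unique:
  assumes "\<And>n. vanishes_upto (int n) (\<Gamma> - (\<Sum>k<n. R k))"
  shows "\<Lambda> = \<Gamma>"
proof -
  have "vanishes_upto (int n) (\<Lambda> - \<Gamma>)" for n
    using vanishes_upto_diff[OF Lambda_approx assms, of n] by simp
  then show ?thesis
    using vanishes_upto_all_imp_0[of "\<Lambda> - \<Gamma>"] by simp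
qed

lemma R_subst:
  assumes "degree P \<ge> 1"
  shows "laurent_subst (R k) P
    = of_nat M * (laurent_of_poly P ^ 2 ^ k) ^ (N - 1) / ((laurent_of_poly P ^ 2 ^ k) ^ N + 1)"
  using assms unfolding R_def
  by (simp add: laurent_subst_divide laurent_subst_add laurent_subst_mult laurent_subst_power
    laurent_subst_X_inv fls_of_nat)

lemma Lambda_square: "laurent_subst \<Lambda> (monom 1 2) = \<Lambda> - R 0"
proof -
  have deg: "degree (monom 1 2 :: 'a poly) \<ge> 1"
    by (simp add: degree_monom_eq)
  have R: "laurent_subst (R k) (monom 1 2) = R (Suc k)" for k
    by (simp add: R_subst[OF deg] laurent_of_poly_monom) (simp add: R_def power_mult)
  have "\<Lambda> = laurent_subst \<Lambda> (monom 1 2) + R 0"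
  proof (rule Lambda_unique)
    fix n
    have "vanishes_upto (int n) (laurent_subst (\<Lambda> - (\<Sum>k<n. R k)) (monom 1 2) + R n)"
      by (intro vanishes_upto_add vanishes_upto_laurent_substI deg Lambda_approx vanishes_upto_R)
    also have "laurent_subst (\<Lambda> - (\<Sum>k<n. R k)) (monom 1 2) + R n
      = laurent_subst \<Lambda> (monom 1 2) - (\<Sum>k<n. R (Suc k)) + R n"
      by (simp add: laurent_subst_diff[OF deg] laurent_subst_sum[OF deg] R)
    also have "(\<Sum>k<n. R (Suc k)) = (\<Sum>k<n. R k) + R n - R 0"
      by (induction n) simp_all
    finally show "vanishes_upto (int n) (laurent_subst \<Lambda> (monom 1 2) + R 0 - (\<Sum>k<n. R k))"
      by (simp add: algebra_simps)
  qed
  then show ?thesis by (simp add: algebra_simps)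
qed

lemma Lambda_negate: "laurent_subst \<Lambda> [:0, -1:] = \<Lambda> - 2 * R 0"
proof -
  have deg: "degree [:0, -1 :: 'a:] \<ge> 1"
    by simp
  have X: "laurent_of_poly [:0, -1:] = (- fls_X_inv :: 'a fls)"
    by (simp add: laurent_of_poly_pCons fls_const_uminus)
  have R: "laurent_subst (R k) [:0, -1:] = (if k = 0 then - R 0 else R k)" for k
  proof (cases k)
    case 0
    have "even N" "odd (N - 1)"
      using M_pos by (simp_all add: N_eq)
    then show ?thesis
      by (simp only: R_subst[OF deg] X) (simp add: R_def 0 power_minus_odd)
  qed (simp add: R_subst X, simp add: R_def)
  have "\<Lambda> = laurent_subst \<Lambda> [:0, -1:] + 2 * R 0"
  proof (rule Lambda_unique)
    fix n
    have "vanishes_upto (int n) (\<Lambda> - (\<Sum>k<Suc n. R k))"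
      using Lambda_approx[of "Suc n"] by (rule vanishes_upto_mono) simp
    then have "vanishes_upto (int n) (laurent_subst (\<Lambda> - (\<Sum>k<Suc n. R k)) [:0, -1:] + R n)"
      by (intro vanishes_upto_add vanishes_upto_laurent_substI deg vanishes_upto_R)
    also have "laurent_subst (\<Lambda> - (\<Sum>k<Suc n. R k)) [:0, -1:] + R n
      = laurent_subst \<Lambda> [:0, -1:] - (\<Sum>k<Suc n. if k = 0 then - R 0 else R k) + R n"
      by (simp only: laurent_subst_diff[OF deg] laurent_subst_sum[OF deg] R)
    also have "(\<Sum>k<Suc n. if k = 0 then - R 0 else R k) = (\<Sum>k<n. R k) + R n - 2 * R 0"
      by (induction n) simp_all
    finally show "vanishes_upto (int n) (laurent_subst \<Lambda> [:0, -1:] + 2 * R 0 - (\<Sum>k<n. R k))"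
      by (simp add: algebra_simps)
  qed
  then show ?thesis by (simp add: algebra_simps)
qed

lemma freshman_fls: "(\<Gamma> + \<Delta>) ^ p = \<Gamma> ^ p + (\<Delta> ^ p :: 'a fls)"
  using prime_p by (intro freshmans_dream) (simp_all add: p_CHAR)

lemma freshman_fls_diff: "(\<Gamma> - \<Delta>) ^ p = \<Gamma> ^ p - (\<Delta> ^ p :: 'a fls)"
  using freshman_fls[of "\<Gamma> - \<Delta>" \<Delta>] by (simp add: algebra_simps)

lemma freshman_fls_sum: "sum f S ^ p = (\<Sum>x\<in>S. f x ^ p :: 'a fls)"
  using prime_p by (intro freshmans_dream_sum) (simp_all add: p_CHAR)

text \<open>
  This says that the coefficients of \<open>\<Lambda>\<close> lie in the prime field, since \<open>\<Gamma>(t)\<^sup>p\<close> arises from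
  \<open>\<Gamma>(t\<^sup>p)\<close> by raising every coefficient to the \<open>p\<close>-th power. In this form it can be proved like the
  other functional equations.
\<close>

lemma Lambda_frobenius: "\<Lambda> ^ p = laurent_subst \<Lambda> (monom 1 p)"
proof -
  have deg: "degree (monom 1 p :: 'a poly) \<ge> 1"
    using p_gt_2 by (simp add: degree_monom_eq)
  have c: "of_nat M ^ p = (of_nat M :: 'a fls)"
    using fermat[of "of_nat M"] by (metis fls_const_power fls_of_nat of_int_of_nat_eq rangeI)
  have R: "laurent_subst (R k) (monom 1 p) = R k ^ p" for k
    by (simp add: R_subst[OF deg] laurent_of_poly_monom)
      (simp add: R_def power_divide power_mult_distrib freshman_fls c power_mult[symmetric] mult.commute mult.left_commute)
  have "vanishes_upto (int n) (\<Lambda> ^ p - laurent_subst \<Lambda> (monom 1 p))" for n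
  proof -
    let ?\<Delta> = "\<Lambda> - (\<Sum>k<n. R k)"
    have "vanishes_upto (int p * int n) (?\<Delta> ^ p)"
      using p_gt_2 Lambda_approx[of n] by (simp add: vanishes_upto_power)
    then have "vanishes_upto (int n) (?\<Delta> ^ p)"
      by (rule vanishes_upto_mono) (use p_gt_2 in \<open>simp flip: of_nat_mult\<close>)
    then have "vanishes_upto (int n) (?\<Delta> ^ p - laurent_subst ?\<Delta> (monom 1 p))"
      by (intro vanishes_upto_diff vanishes_upto_laurent_substI deg Lambda_approx)
    then show ?thesis
      by (simp add: laurent_subst_diff[OF deg] laurent_subst_sum[OF deg] R freshman_fls_diff freshman_fls_sum)
  qed
  then show ?thesis
    using vanishes_upto_all_imp_0[of "\<Lambda> ^ p - laurent_subst \<Lambda> (monom 1 p)"] by simp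
qed

end

section \<open>Parity and Frobenius for polynomials\<close>

text \<open>
  The factor \<open>g\<close> is a greatest common divisor. The relation between the cofactors is what makes
  \<open>a'/b'\<close> a reduced form of \<open>a/b\<close>.
\<close>

lemma bezout_cofactors:
  fixes a b :: "'a::euclidean_ring"
  shows "\<exists>g a' b' u v. a = g * a' \<and> b = g * b' \<and> u * a' + v * b' = 1"
proof (induction "euclidean_size b" arbitrary: a b rule: less_induct)
  case less
  show ?case
  proof (cases "b = 0")
    case True
    then have "a = a * 1 \<and> b = a * 0 \<and> 1 * 1 + 0 * 0 = (1 :: 'a)"
      by simp
    then show ?thesis by blast
  next
    case False
    then obtain g b' c u v where *: "b = g * b'" "a mod b = g * c" "u * b' + v * c = 1"
      using less[of "a mod b" b] mod_size_less[of b a] by blast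
    have "a = g * (a div b * b' + c)"
      using div_mult_mod_eq[of a b] * by (metis distrib_left mult.left_commute)
    moreover have "v * (a div b * b' + c) + (u - v * (a div b)) * b' = 1"
      using *(3) by (simp add: algebra_simps)
    ultimately show ?thesis using *(1) by blast
  qed
qed

lemma prod_root_factors_dvd:
  fixes Q :: "'a::field poly"
  assumes "finite S" "\<And>x. x \<in> S \<Longrightarrow> poly Q x = 0"
  shows "(\<Prod>x\<in>S. [:-x, 1:]) dvd Q"
  using assms
proof (induction S rule: finite_induct)
  case (insert x S)
  then obtain A where A: "Q = (\<Prod>x\<in>S. [:-x, 1:]) * A"
    by (metis dvdE insertCI)
  have "poly (\<Prod>x\<in>S. [:-x, 1:]) x \<noteq> 0"
    using insert by (auto simp: poly_prod)
  then have "poly A x = 0"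
    using insert.prems[of x] by (auto simp: A)
  then have "[:-x, 1:] dvd A"
    by (simp add: poly_eq_0_iff_dvd)
  then show ?case
    unfolding prod.insert[OF insert.hyps] A by (metis dvd_refl mult.commute mult_dvd_mono)
qed simp

abbreviation at_square :: "'a::comm_ring_1 poly \<Rightarrow> 'a poly" where
  "at_square Q \<equiv> pcompose Q (monom 1 2)"

abbreviation at_minus :: "'a::comm_ring_1 poly \<Rightarrow> 'a poly" where
  "at_minus Q \<equiv> pcompose Q [:0, -1:]"

lemma monom_pcompose: "pcompose (monom 1 n) Q = Q ^ n"
  for Q :: "'a::comm_ring_1 poly"
  by (induction n) (simp_all add: monom_0 monom_Suc pcompose_pCons pcompose_1 flip: one_pCons)

lemma at_minus_monom: "at_minus (monom 1 n) = (-1) ^ n * monom 1 n"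
proof -
  have "[:0, -1 :: 'a:] = (-1) * monom 1 1"
    by (simp add: monom_altdef)
  then show ?thesis
    by (simp only: monom_pcompose power_mult_distrib monom_power) simp
qed

lemma at_minus_at_square: "at_minus (at_square Q) = at_square Q"
proof -
  have "at_minus (monom 1 2) = (monom 1 2 :: 'a poly)"
    by (simp add: at_minus_monom)
  then show ?thesis
    by (simp add: pcompose_assoc[symmetric])
qed

lemma at_minus_X: "at_minus (monom 1 1) = - monom 1 1"
  using at_minus_monom[of 1] by simp

text \<open>
  The set \<open>F\<close> serves to carry along that all coefficients lie in the prime field.
\<close>

lemma parity_decomposition:
  fixes Q :: "'a::comm_ring_1 poly"
  assumes "\<And>i. coeff Q i \<in> F"
  obtains U V where "Q = at_square U + monom 1 1 * at_square V"
    and "\<And>i. coeff U i \<in> F" and "\<And>i. coeff V i \<in> F"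
proof -
  have "\<exists>U V. Q = at_square U + monom 1 1 * at_square V \<and> range (coeff U) \<subseteq> F \<and> range (coeff V) \<subseteq> F"
    using assms
  proof (induction Q)
    case 0
    then show ?case
      by (intro exI[of _ 0]) auto
  next
    case (pCons a Q)
    have "coeff Q i \<in> F" for i
      using pCons.prems[of "Suc i"] by simp
    with pCons.IH obtain U V where UV: "Q = at_square U + monom 1 1 * at_square V"
      "range (coeff U) \<subseteq> F" "range (coeff V) \<subseteq> F"
      by blast
    have *: "pCons a A = [:a:] + monom 1 1 * A" for a and A :: "'a poly"
      by (simp add: monom_altdef)
    have "monom 1 2 = monom 1 1 * (monom 1 1 :: 'a poly)"
      by (simp add: mult_monom numeral_2_eq_2)
    then have "pCons a Q = at_square (pCons a V) + monom 1 1 * at_square U"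
      by (simp only: *[of a Q] pcompose_pCons) (simp add: UV(1) algebra_simps)
    moreover have "range (coeff (pCons a V)) \<subseteq> F"
      using UV(3) pCons.prems[of 0] by (auto simp: coeff_pCons image_subset_iff split: nat.split)
    ultimately show ?case using UV(2) by blast
  qed
  then show ?thesis using that by blast
qed

context odd_characteristic
begin

lemma two_mult_eq_0_iff: "2 * Q = 0 \<longleftrightarrow> Q = (0 :: 'a poly)"
proof -
  have "coeff (2 * Q) i = 2 * coeff Q i" for i
    unfolding mult_2 coeff_add ..
  then show ?thesis
    using two_neq_0 by (simp add: poly_eq_iff)
qed

lemma parity_unique:
  assumes "at_square C + monom 1 1 * at_square D = (0 :: 'a poly)"
  shows "C = 0" and "D = 0"
proof -
  have "at_minus (at_square C + monom 1 1 * at_square D) = 0"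
    by (simp only: assms pcompose_0)
  then have *: "at_square C - monom 1 1 * at_square D = 0"
    by (simp only: pcompose_add pcompose_mult at_minus_at_square at_minus_X) simp
  have "2 * at_square C = 0" "2 * (monom 1 1 * at_square D) = 0"
    using assms * by algebra+
  then show "C = 0" "D = 0"
    by (simp_all only: two_mult_eq_0_iff) (simp_all add: pcompose_eq_0_iff degree_monom_eq)
qed

definition frob :: "'a poly \<Rightarrow> 'a poly" where "frob = map_poly (\<lambda>x. x ^ p)"

lemma frob_pCons [simp]: "frob (pCons a Q) = pCons (a ^ p) (frob Q)"
  using p_gt_2 by (simp add: frob_def map_poly_pCons power_0_left)

lemma frob_0 [simp]: "frob 0 = 0"
  by (simp add: frob_def)

lemma coeff_frob: "coeff (frob Q) i = coeff Q i ^ p"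
  using p_gt_2 by (simp add: frob_def coeff_map_poly power_0_left)

lemma degree_frob: "degree (frob Q) = degree Q"
  unfolding frob_def by (cases "Q = 0") (use p_gt_2 in \<open>auto intro: map_poly_degree_eq\<close>)

lemma frob_eq_0_iff: "frob Q = 0 \<longleftrightarrow> Q = 0"
  using prime_gt_0_nat[OF prime_p] by (simp add: poly_eq_iff coeff_frob)

lemma freshman_field: "(x + y) ^ p = x ^ p + (y ^ p :: 'a)"
  using prime_p by (intro freshmans_dream) (simp_all add: p_CHAR)

lemma poly_frob: "poly (frob Q) (x ^ p) = poly Q x ^ p"
  using p_gt_2 by (induction Q) (simp_all add: freshman_field power_mult_distrib power_0_left)

lemma power_p_eq_frob: "Q ^ p = pcompose (frob Q) (monom 1 p)"
proof (induction Q)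
  case 0
  then show ?case using p_gt_2 by (simp add: power_0_left)
next
  case (pCons a Q)
  have "pCons a Q = [:a:] + monom 1 1 * Q"
    by (simp add: monom_altdef)
  then have "pCons a Q ^ p = [:a:] ^ p + (monom 1 1 * Q) ^ p"
    using prime_p by (simp only:) (intro freshmans_dream, simp_all add: p_CHAR)
  also have "\<dots> = [:a ^ p:] + monom 1 p * Q ^ p"
    by (simp add: power_mult_distrib monom_power poly_const_pow)
  finally show ?case
    by (simp add: pCons.IH pcompose_pCons)
qed

end

context odd_characteristic
begin

section \<open>Good approximations\<close>

lemma finite_mu_N_subset: "finite {x :: 'a. x ^ N = 1 \<and> P x}"
  by (rule finite_subset[OF _ finite_mu_N]) auto

definition defect :: "'a poly \<Rightarrow> nat" where
  "defect Q = card {x. x ^ N = 1 \<and> poly Q x \<noteq> 0}"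

text \<open>
  The term \<open>2 * defect Q\<close> makes the comparison of the approximations at \<open>t\<close> and \<open>-t\<close> exact. The
  descent at least halves it, while it halves \<open>deg Q\<close> and the order of the error. Unreduced fractions are admitted
  because the descent need not produce reduced ones.
\<close>

definition approx :: "nat \<Rightarrow> 'a poly \<Rightarrow> 'a poly \<Rightarrow> bool" where
  "approx n Q S \<longleftrightarrow> Q \<noteq> 0 \<and> vanishes_upto (int (degree Q + 2 * defect Q))
     (laurent_of_poly (monom 1 n * Q) * \<Lambda> - laurent_of_poly S)"

lemma approx_nonzero: "approx n Q S \<Longrightarrow> Q \<noteq> 0"
  by (simp add: approx_def)

lemma defect_le: "defect Q \<le> N"
  unfolding defect_def using card_mu_N finite_mu_N
  by (metis (no_types, lifting) card_mono mem_Collect_eq subsetI)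

lemma card_zeros_plus_defect: "card {x. x ^ N = 1 \<and> poly Q x = 0} + defect Q = N"
  unfolding defect_def
  by (subst card_Un_disjoint[symmetric])
    (auto simp: finite_mu_N_subset card_mu_N intro!: arg_cong[where f = card] trans[OF _ card_mu_N])

lemma defect_le_defect_mult:
  assumes "A \<noteq> 0"
  shows "defect Q \<le> defect (A * Q) + degree A"
proof -
  have "defect Q \<le> card ({x. x ^ N = 1 \<and> poly (A * Q) x \<noteq> 0} \<union> {x. poly A x = 0})"
    unfolding defect_def
    by (rule card_mono) (use assms finite_mu_N_subset in \<open>auto simp: poly_roots_finite\<close>)
  also have "\<dots> \<le> defect (A * Q) + card {x. poly A x = 0}"
    unfolding defect_def by (rule card_Un_le)
  also have "card {x. poly A x = 0} \<le> degree A"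
    using assms by (rule card_poly_roots_bound)
  finally show ?thesis by simp
qed

text \<open>
  Cancelling \<open>g\<close> improves the error by \<open>deg g\<close> and lowers the degree of the denominator by \<open>deg g\<close>,
  which pays for the at most \<open>deg g\<close> zeros of \<open>g\<close> by which the defect grows.
\<close>

lemma approx_cancel:
  assumes "approx n (g * Q) (g * S)"
  shows "approx n Q S"
proof -
  have nz: "g \<noteq> 0" "Q \<noteq> 0"
    using assms by (auto simp: approx_def)
  have "laurent_of_poly (monom 1 n * (g * Q)) * \<Lambda> - laurent_of_poly (g * S)
    = laurent_of_poly g * (laurent_of_poly (monom 1 n * Q) * \<Lambda> - laurent_of_poly S)"
    by (simp add: laurent_of_poly_mult algebra_simps)
  with assms nz have "vanishes_upto (int (degree (g * Q) + 2 * defect (g * Q)) + int (degree g))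
      (laurent_of_poly (monom 1 n * Q) * \<Lambda> - laurent_of_poly S)"
    by (simp add: approx_def vanishes_upto_mult_poly)
  moreover have "int (degree Q + 2 * defect Q)
    \<le> int (degree (g * Q) + 2 * defect (g * Q)) + int (degree g)"
    using defect_le_defect_mult[OF nz(1), of Q] nz by (simp add: degree_mult_eq)
  ultimately show ?thesis
    using nz vanishes_upto_mono unfolding approx_def by blast
qed

lemma approx_shift:
  assumes "approx n (monom 1 1 * Q) S"
  shows "approx (Suc n) Q S"
proof -
  have nz: "Q \<noteq> 0"
    using assms by (auto simp: approx_def)
  have "x \<noteq> 0" if "x ^ N = 1" for x :: 'a
    using that by (auto simp: power_0_left N_def)
  then have defect: "defect (monom 1 1 * Q) = defect Q"
    unfolding defect_def by (intro arg_cong[where f = card]) (auto simp: poly_monom)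
  have eq: "monom 1 n * (monom 1 1 * Q) = monom 1 (Suc n) * Q"
    by (simp add: mult.assoc[symmetric] mult_monom)
  have "degree Q \<le> degree (monom 1 1 * Q)"
    using nz by (simp add: degree_mult_eq)
  then show ?thesis
    using assms nz unfolding approx_def defect eq by (auto elim: vanishes_upto_mono)
qed

lemma approx_unshift:
  assumes "approx (Suc n) Q (monom 1 1 * S)"
  shows "approx n Q S"
proof -
  have "laurent_of_poly (monom 1 (Suc n) * Q) * \<Lambda> - laurent_of_poly (monom 1 1 * S)
    = laurent_of_poly (monom 1 1) * (laurent_of_poly (monom 1 n * Q) * \<Lambda> - laurent_of_poly S)"
    by (simp add: laurent_of_poly_mult laurent_of_poly_monom algebra_simps)
  then show ?thesis
    using assms unfolding approx_def
    by (auto simp: vanishes_upto_mult_poly elim: vanishes_upto_mono)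
qed

text \<open>
  With \<open>\<Gamma>\<close> the error of \<open>S/(t\<^sup>n Q)\<close> and \<open>\<Delta>\<close> that of the conjugate fraction, \<open>\<Gamma>\<^sup>p = \<Delta>(t\<^sup>p)\<close>. Both sides
  have \<open>p\<close> times the order of the series they come from.
\<close>

lemma approx_frob:
  assumes "approx n Q S"
  shows "approx n (frob Q) (frob S)"
proof -
  have deg: "degree (monom 1 p :: 'a poly) \<ge> 1"
    using p_gt_2 by (simp add: degree_monom_eq)
  define k where "k = int (degree Q + 2 * defect Q)"
  define \<Gamma> where "\<Gamma> = laurent_of_poly (monom 1 n * Q) * \<Lambda> - laurent_of_poly S"
  define \<Delta> where "\<Delta> = laurent_of_poly (monom 1 n * frob Q) * \<Lambda> - laurent_of_poly (frob S)"
  have defect: "defect (frob Q) = defect Q"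
  proof -
    have "poly (frob Q) x = poly Q x ^ p" if "x ^ N = 1" for x
      using poly_frob[of Q x] mu_N_Fp[OF that] by simp
    then show ?thesis
      using p_gt_2 unfolding defect_def by (intro arg_cong[where f = card]) auto
  qed
  have "\<Gamma> ^ p = laurent_of_poly ((monom 1 n * Q) ^ p) * \<Lambda> ^ p - laurent_of_poly (S ^ p)"
    by (simp add: \<Gamma>_def freshman_fls_diff power_mult_distrib[of _ \<Lambda>] laurent_of_poly_power)
  also have "(monom 1 n * Q) ^ p = pcompose (monom 1 n * frob Q) (monom 1 p)"
    by (simp add: power_mult_distrib pcompose_mult power_p_eq_frob[of Q] monom_pcompose monom_power mult.commute)
  also have "S ^ p = pcompose (frob S) (monom 1 p)"
    by (rule power_p_eq_frob)
  finally have "\<Gamma> ^ p = laurent_subst \<Delta> (monom 1 p)"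
    by (simp add: \<Delta>_def laurent_subst_diff[OF deg] laurent_subst_mult[OF deg]
        laurent_subst_laurent_of_poly[OF deg] Lambda_frobenius)
  moreover have "vanishes_upto (int p * k) (\<Gamma> ^ p)"
    using assms p_gt_2 by (simp add: vanishes_upto_power \<Gamma>_def k_def approx_def)
  ultimately have "vanishes_upto k \<Delta>"
    using vanishes_upto_laurent_subst[OF deg, of k \<Delta>] by (simp add: degree_monom_eq)
  then show ?thesis
    using assms by (simp add: approx_def \<Delta>_def k_def defect degree_frob frob_eq_0_iff)
qed

lemma denominator_times_R0:
  "laurent_of_poly (monom 1 N + 1) * R 0 = laurent_of_poly (of_nat M * monom 1 (N - 1))"
proof -
  have "laurent_of_poly (of_nat k) = (of_nat k :: 'a fls)" for k
    by (induction k) (simp_all add: laurent_of_poly_add)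
  moreover have "fls_X_inv ^ N + 1 \<noteq> (0 :: 'a fls)"
    using M_pos N_eq by (intro denominator_neq_0) simp
  ultimately show ?thesis
    by (simp add: R_def laurent_of_poly_add laurent_of_poly_mult laurent_of_poly_monom)
qed

text \<open>
  Multiply \<open>S/(t\<^sup>n Q) - S(-t)/((-t)\<^sup>n Q(-t)) - 2R\<close> by the common denominator. Up to sign, the result \<open>Y\<close>
  is a polynomial, and its degree is negative because the zeros of \<open>Q\<close> that come in pairs \<open>x, -x\<close> of \<open>N\<close>-th roots
  of unity contribute a factor \<open>B\<close> common to \<open>Q(t)\<close> and \<open>Q(-t)\<close>. Hence \<open>Y = 0\<close>.
\<close>

lemma approx_identity:
  assumes "approx n Q S"
  shows "of_nat N * monom 1 (N - 1 + n) * Q * at_minus Q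
    = (monom 1 N + 1) * (at_minus Q * S - (-1) ^ n * Q * at_minus S)"
proof -
  let ?L = "laurent_of_poly :: 'a poly \<Rightarrow> 'a fls"
  let ?T = "monom 1 N + 1 :: 'a poly"
  define Z where "Z = {x. x ^ N = 1 \<and> poly Q x = 0 \<and> poly Q (-x) = 0}"
  define B where "B = (\<Prod>x\<in>Z. [:-x, 1:])"
  have fin: "finite Z"
    unfolding Z_def by (rule finite_mu_N_subset)
  have nz: "Q \<noteq> 0"
    using assms by (rule approx_nonzero)
  \<comment> \<open>At most \<open>defect Q\<close> of the \<open>N\<close>-th roots of unity are lost because \<open>Q(x) \<noteq> 0\<close>, and as many because
      \<open>Q(-x) \<noteq> 0\<close>.\<close>
  have "N \<le> card Z + 2 * defect Q"
  proof -
    have "even N" by (simp add: N_eq)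
    then have minus: "(- x) ^ N = x ^ N" for x :: 'a
      by simp
    have "bij_betw uminus {x. x ^ N = 1 \<and> poly Q (-x) \<noteq> 0} {x. x ^ N = 1 \<and> poly Q x \<noteq> 0}"
      by (rule bij_betw_byWitness[where f' = uminus]) (auto simp: minus)
    then have "card {x. x ^ N = 1 \<and> poly Q (-x) \<noteq> 0} = defect Q"
      unfolding defect_def by (rule bij_betw_same_card)
    moreover have "N \<le> card (Z \<union> ({x. x ^ N = 1 \<and> poly Q x \<noteq> 0} \<union> {x. x ^ N = 1 \<and> poly Q (-x) \<noteq> 0}))"
      by (subst card_mu_N[symmetric], rule card_mono) (use fin finite_mu_N_subset in \<open>auto simp: Z_def\<close>)
    moreover have "\<dots> \<le> card Z + (card {x. x ^ N = 1 \<and> poly Q x \<noteq> 0} + card {x. x ^ N = 1 \<and> poly Q (-x) \<noteq> 0})"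
      by (meson add_left_mono card_Un_le le_trans)
    ultimately show ?thesis
      by (simp add: defect_def)
  qed
  have degB: "degree B = card Z"
    by (simp add: B_def degree_prod_eq_sum_degree)
  have "B dvd Q" "B dvd at_minus Q"
    unfolding B_def using fin by (intro prod_root_factors_dvd; auto simp: Z_def poly_pcompose)+
  then obtain Q1 Q2 where Q1: "Q = B * Q1" and Q2: "at_minus Q = B * Q2"
    by (metis dvdE)
  have "at_minus Q \<noteq> 0"
    using nz by (simp add: pcompose_eq_0_iff)
  then have nz': "B \<noteq> 0" "Q1 \<noteq> 0" "Q2 \<noteq> 0"
    using nz Q1 Q2 by auto
  have deg: "degree Q = card Z + degree Q1" "degree Q = card Z + degree Q2"
  proof -
    show "degree Q = card Z + degree Q1"
      using nz' by (simp add: Q1 degree_mult_eq degB)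
    have "degree Q = degree (at_minus Q)"
      by (simp add: degree_pcompose)
    then show "degree Q = card Z + degree Q2"
      using nz' by (simp add: Q2 degree_mult_eq degB)
  qed
  define k where "k = int (degree Q + 2 * defect Q)"
  define \<Gamma> where "\<Gamma> = ?L (monom 1 n * Q) * \<Lambda> - ?L S"
  define \<Delta> where "\<Delta> = laurent_subst \<Gamma> [:0, -1:]"
  have van: "vanishes_upto k \<Gamma>"
    using assms by (simp add: approx_def k_def \<Gamma>_def)
  then have van': "vanishes_upto k \<Delta>"
    using vanishes_upto_laurent_subst[of "[:0, -1 :: 'a:]" k \<Gamma>] by (simp add: \<Delta>_def)
  have \<Delta>: "\<Delta> = ?L ((-1) ^ n * monom 1 n * at_minus Q) * (\<Lambda> - 2 * R 0) - ?L (at_minus S)"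
    by (simp add: \<Delta>_def \<Gamma>_def laurent_subst_diff laurent_subst_mult Lambda_negate
        laurent_subst_laurent_of_poly pcompose_mult at_minus_monom)
  have T: "?T \<noteq> 0" "degree ?T = N"
    using degree_monom_one_add[of N 1] M_pos N_eq by (simp_all flip: one_pCons)
  have bound: "vanishes_upto 0 (?L (?T * A) * \<Theta>)"
    if "A \<noteq> 0" "degree Q = card Z + degree A" "vanishes_upto k \<Theta>" for A \<Theta>
  proof -
    have "degree (?T * A) = N + degree A"
      using that T by (simp add: degree_mult_eq)
    then have "0 + int (degree (?T * A)) \<le> k"
      using that \<open>N \<le> card Z + 2 * defect Q\<close> by (simp add: k_def)
    then show ?thesis
      using that T by (subst vanishes_upto_mult_poly) (auto elim: vanishes_upto_mono)
  qed
  define Y where "Y = of_nat N * monom 1 (N - 1 + n) * B * Q1 * Q2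
    - ?T * (Q2 * S - (-1) ^ n * Q1 * at_minus S)"
  have sign: "(-1) ^ n * (-1) ^ n = (1 :: 'a poly)"
    by (simp flip: power_mult_distrib)
  have "?L (?T * Q2) * \<Gamma> - ?L ((-1) ^ n) * (?L (?T * Q1) * \<Delta>)
    = ?L (monom 1 n * Q1 * Q2 * B) * (?L ?T * \<Lambda> - ?L ((-1) ^ n * (-1) ^ n) * (?L ?T * \<Lambda> - 2 * (?L ?T * R 0)))
      - ?L (?T * (Q2 * S - (-1) ^ n * Q1 * at_minus S))"
    unfolding \<Delta> \<Gamma>_def Q2 unfolding Q1 laurent_of_poly_mult laurent_of_poly_diff by algebra
  also have "\<dots> = ?L Y"
  proof -
    have "2 * (of_nat M * monom 1 (N - 1)) * monom 1 n = (of_nat N * monom 1 (N - 1 + n) :: 'a poly)"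
      by (simp add: N_eq mult_monom mult.assoc)
    then have "?L Y = ?L (monom 1 n * Q1 * Q2 * B) * (2 * ?L (of_nat M * monom 1 (N - 1)))
       - ?L (?T * (Q2 * S - (-1) ^ n * Q1 * at_minus S))"
      unfolding Y_def laurent_of_poly_diff mult_2 laurent_of_poly_add[symmetric] laurent_of_poly_mult[symmetric] 
      by (simp add: algebra_simps)
    then show ?thesis
      unfolding sign denominator_times_R0 by simp
  qed
  finally have "vanishes_upto 0 (?L Y)"
  proof -
    assume eq: "?L (?T * Q2) * \<Gamma> - ?L ((-1) ^ n) * (?L (?T * Q1) * \<Delta>) = ?L Y"
    have "(-1 :: 'a poly) ^ n \<noteq> 0" "degree ((-1 :: 'a poly) ^ n) = 0"
      by (cases "even n"; simp)+
    then have "vanishes_upto 0 (?L ((-1) ^ n) * (?L (?T * Q1) * \<Delta>))"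
      using bound[of Q1 \<Delta>] nz' deg van' by (subst vanishes_upto_mult_poly) auto
    with bound[of Q2 \<Gamma>] nz' deg van show ?thesis
      unfolding eq[symmetric] by (intro vanishes_upto_diff) auto
  qed
  then have "Y = 0"
    by (simp add: vanishes_upto_laurent_of_poly)
  then have "B * Y = 0" by simp
  then show ?thesis
    unfolding Y_def Q2 unfolding Q1 by (simp add: algebra_simps)
qed

end

context odd_characteristic
begin

section \<open>Descent\<close>

lemma approx_scale:
  assumes "approx n Q S" "c \<noteq> 0"
  shows "approx n (smult c Q) (smult c S)"
proof (rule approx_cancel)
  show "approx n ([:inverse c:] * smult c Q) ([:inverse c:] * smult c S)"
    using assms by simp
qed

text \<open>
  Two approximations of this quality with denominators of the same degree are equal as fractions. So
  the given fraction equals its Frobenius conjugate; being reduced with monic denominator, it has the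
  same denominator.
\<close>

lemma frob_fixed:
  assumes approx: "approx n Q S" and "lead_coeff Q = 1" and bezout: "u * S + v * Q = 1"
  shows "frob Q = Q"
proof -
  let ?L = "laurent_of_poly :: 'a poly \<Rightarrow> 'a fls"
  define \<Gamma> where "\<Gamma> = ?L (monom 1 n * Q) * \<Lambda> - ?L S"
  define \<Delta> where "\<Delta> = ?L (monom 1 n * frob Q) * \<Lambda> - ?L (frob S)"
  have nz: "Q \<noteq> 0" "frob Q \<noteq> 0"
    using approx by (auto simp: approx_def frob_eq_0_iff)
  have "vanishes_upto (int (degree Q)) \<Gamma>" "vanishes_upto (int (degree Q)) \<Delta>"
    using approx approx_frob[OF approx] unfolding approx_def \<Gamma>_def \<Delta>_def degree_frob
    by (auto elim: vanishes_upto_mono)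
  then have "vanishes_upto 0 (?L (frob Q) * \<Gamma> - ?L Q * \<Delta>)"
    using nz by (intro vanishes_upto_diff) (simp_all add: vanishes_upto_mult_poly degree_frob)
  also have "?L (frob Q) * \<Gamma> - ?L Q * \<Delta> = ?L (Q * frob S - frob Q * S)"
    by (simp add: \<Gamma>_def \<Delta>_def laurent_of_poly_mult laurent_of_poly_diff algebra_simps)
  finally have "Q * frob S - frob Q * S = 0"
    by (simp only: vanishes_upto_laurent_of_poly)
  then have eq: "frob Q * S = Q * frob S"
    by simp
  have "frob Q = u * (frob Q * S) + v * Q * frob Q"
    using bezout by algebra
  also have "\<dots> = Q * (u * frob S + v * frob Q)"
    unfolding eq by (simp add: algebra_simps)
  finally obtain k where k: "frob Q = Q * k"
    by blast
  then have "degree (frob Q) = degree Q + degree k"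
    using nz by (metis degree_mult_eq mult_zero_right)
  then have "degree k = 0"
    by (simp add: degree_frob)
  then obtain c where c: "k = [:c:]"
    by (rule degree_eq_zeroE)
  have "1 = lead_coeff (frob Q)"
    using \<open>lead_coeff Q = 1\<close> by (simp add: coeff_frob degree_frob)
  also have "\<dots> = c"
    using \<open>lead_coeff Q = 1\<close> by (simp add: k c)
  finally show ?thesis
    by (simp add: k c flip: one_pCons)
qed

lemma at_square_star_poly: "at_square star_poly = monom 1 N + 1"
  by (simp add: star_poly_eq pcompose_add pcompose_1 monom_pcompose monom_power N_eq mult.commute flip: one_pCons)

text \<open>
  Write \<open>Q = U(t\<^sup>2) + t V(t\<^sup>2)\<close>, so that \<open>Q(t) Q(-t) = (U\<^sup>2 - x V\<^sup>2)(t\<^sup>2)\<close>. At \<open>x = \<zeta>\<close> the hypothesis gives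
  \<open>U(\<zeta>)\<^sup>2 = \<zeta> V(\<zeta>)\<^sup>2\<close> with both values in the prime field, where \<open>\<zeta>\<close> is not a square. Hence both vanish.
\<close>

lemma star_denominator:
  assumes id: "of_nat N * monom 1 k * Q * at_minus Q = (monom 1 N + 1) * Y"
    and "frob Q = Q"
  obtains Q' where "Q = (monom 1 N + 1) * Q'"
proof -
  have fix_F: "poly A x = poly A x ^ p" if "\<And>i. coeff A i \<in> {a. a ^ p = a}" "x ^ p = x" for A and x :: 'a
  proof -
    have "frob A = A"
      using that(1) by (simp add: poly_eq_iff coeff_frob)
    then show ?thesis
      using poly_frob[of A x] that(2) by simp
  qed
  have "coeff Q i \<in> {a. a ^ p = a}" for i
    using arg_cong[OF \<open>frob Q = Q\<close>, of "\<lambda>A. coeff A i"] by (simp add: coeff_frob)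
  then obtain U V where Q: "Q = at_square U + monom 1 1 * at_square V"
    and U: "\<And>i. coeff U i \<in> {a. a ^ p = a}" and V: "\<And>i. coeff V i \<in> {a. a ^ p = a}"
    by (rule parity_decomposition) blast
  \<comment> \<open>The extra factor \<open>t\<^sup>k\<close> turns \<open>t\<^sup>k\<close> on the left of the identity into a function of \<open>t\<^sup>2\<close>,
      whatever the parity of \<open>k\<close>.\<close>
  obtain C D where CD: "monom 1 k * Y = at_square C + monom 1 1 * at_square D"
    by (rule parity_decomposition[of "monom 1 k * Y" UNIV]) auto
  have sq: "monom 1 j * monom 1 j = at_square (monom 1 j :: 'a poly)" for j
    by (simp add: monom_pcompose monom_power mult_monom mult_2)
  have Qm: "at_minus Q = at_square U - monom 1 1 * at_square V"
    unfolding Q by (simp only: pcompose_add pcompose_mult at_minus_at_square at_minus_X) simp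
  have "Q * at_minus Q = at_square (U * U - monom 1 1 * V * V)"
    unfolding Qm unfolding Q pcompose_diff pcompose_mult sq[symmetric] by (simp add: algebra_simps)
  have N: "at_square (of_nat N) = (of_nat N :: 'a poly)"
    by (simp add: of_nat_poly)
  have "at_square (of_nat N * monom 1 k * (U * U - monom 1 1 * V * V))
    = monom 1 k * (of_nat N * monom 1 k * Q * at_minus Q)"
    unfolding pcompose_mult[of "_ * _"] pcompose_mult[of _ "monom 1 k"] \<open>Q * at_minus Q = _\<close>[symmetric] sq[symmetric] N
    by (simp only: mult_ac)
  also have "\<dots> = at_square star_poly * (monom 1 k * Y)"
    unfolding id at_square_star_poly by (simp only: mult_ac)
  also have "\<dots> = at_square (star_poly * C) + monom 1 1 * at_square (star_poly * D)"
    unfolding CD pcompose_mult by (simp add: algebra_simps)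
  finally have "at_square (of_nat N * monom 1 k * (U * U - monom 1 1 * V * V) - star_poly * C)
     + monom 1 1 * at_square (- (star_poly * D)) = 0"
    unfolding pcompose_diff pcompose_uminus by simp
  from parity_unique(1)[OF this]
  have key: "of_nat N * monom 1 k * (U * U - monom 1 1 * V * V) = star_poly * C"
    by simp
  have zero: "poly U \<zeta> = 0 \<and> poly V \<zeta> = 0" if \<zeta>: "\<zeta> \<in> mu_star r" for \<zeta>
  proof -
    have "poly star_poly \<zeta> = 0"
      using \<zeta> by (simp add: star_poly_eq poly_monom mu_star_eq)
    with arg_cong[OF key, of "\<lambda>A. poly A \<zeta>"]
    have "of_nat N * \<zeta> ^ k * ((poly U \<zeta>)\<^sup>2 - \<zeta> * (poly V \<zeta>)\<^sup>2) = 0"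
      by (simp add: poly_monom power2_eq_square mult.assoc of_nat_poly)
    moreover have "\<zeta> \<noteq> 0"
      using \<zeta> M_pos by (auto simp: mu_star_eq power_0_left)
    moreover have "of_nat N \<noteq> (0 :: 'a)"
      using of_nat_M_neq_0 two_neq_0 by (simp add: N_eq)
    ultimately have "(poly U \<zeta>)\<^sup>2 = \<zeta> * (poly V \<zeta>)\<^sup>2"
      by simp
    moreover have "\<zeta> ^ p = \<zeta>"
      using \<zeta> mu_split by (intro mu_N_Fp) auto
    ultimately show ?thesis
      using mu_star_nonsquare[OF fix_F[OF U, symmetric] fix_F[OF V, symmetric] \<zeta>] by blast
  qed
  have "star_poly dvd U" "star_poly dvd V"
    unfolding star_poly_def using finite_mu_star zero by (auto intro!: prod_root_factors_dvd)
  then obtain U' V' where "U = star_poly * U'" "V = star_poly * V'"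
    by (metis dvdE)
  then have "Q = (monom 1 N + 1) * (at_square U' + monom 1 1 * at_square V')"
    by (simp add: Q pcompose_mult at_square_star_poly algebra_simps)
  then show ?thesis using that by blast
qed

lemma card_square_roots: "card {y :: 'a. y\<^sup>2 = x} \<le> 2"
  and finite_square_roots: "finite {y :: 'a. y\<^sup>2 = x}"
proof -
  have "{y. y\<^sup>2 = x} = {y. poly [:-x, 0, 1:] y = 0}"
    by (auto simp: power2_eq_square)
  then show "card {y. y\<^sup>2 = x} \<le> 2" "finite {y. y\<^sup>2 = x}"
    using card_poly_roots_bound[of "[:-x, 0, 1:]"] poly_roots_finite[of "[:-x, 0, 1:]"] by simp_all
qed

text \<open>
  As \<open>W\<close> vanishes on \<open>mu_star r\<close>, only \<open>M\<close>-th roots of unity contribute to its defect. Zeros are counted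
  instead of nonzeros: the zeros of \<open>W(y\<^sup>2)\<close> lie above zeros of \<open>W\<close>, at most two above each.
\<close>

lemma defect_at_square:
  assumes "star_poly dvd W"
  shows "2 * defect W \<le> defect (at_square W)"
proof -
  define Z where "Z = {x. x ^ M = 1 \<and> poly W x = 0}"
  have fin: "finite {x :: 'a. x ^ M = 1}"
    using card_mu M_pos by (intro card_ge_0_finite) simp
  have star: "poly W x = 0" if "x \<in> mu_star r" for x
  proof -
    have "poly star_poly x = 0"
      using that by (simp add: star_poly_eq poly_monom mu_star_eq)
    then show ?thesis using assms by (auto elim!: dvdE)
  qed
  have "{x. x ^ N = 1 \<and> poly W x = 0} = Z \<union> mu_star r"
    using mu_split star by (auto simp: Z_def)
  moreover have "card (Z \<union> mu_star r) = card Z + M"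
    using fin mu_disjoint finite_mu_star card_mu_star
    by (subst card_Un_disjoint) (auto simp: Z_def intro: rev_finite_subset[OF fin])
  ultimately have W: "card Z + M + defect W = N"
    using card_zeros_plus_defect[of W] by simp
  have "card {y. y ^ N = 1 \<and> poly (at_square W) y = 0} \<le> card (\<Union>x\<in>Z. {y. y\<^sup>2 = x})"
  proof (rule card_mono)
    show "finite (\<Union>x\<in>Z. {y. y\<^sup>2 = x})"
      using fin finite_square_roots by (auto simp: Z_def)
    show "{y. y ^ N = 1 \<and> poly (at_square W) y = 0} \<subseteq> (\<Union>x\<in>Z. {y. y\<^sup>2 = x})"
      by (auto simp: Z_def N_eq power_mult poly_pcompose poly_monom)
  qed
  also have "\<dots> \<le> (\<Sum>x\<in>Z. card {y. y\<^sup>2 = x})"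
    by (rule card_UN_le) (auto simp: Z_def fin)
  also have "\<dots> \<le> (\<Sum>x\<in>Z. 2)"
    by (intro sum_mono card_square_roots)
  finally have "card {y. y ^ N = 1 \<and> poly (at_square W) y = 0} \<le> 2 * card Z"
    by simp
  with card_zeros_plus_defect[of "at_square W"] W show ?thesis
    by (simp add: N_eq)
qed

text \<open>
  After the factor \<open>t\<^sup>N + 1\<close> is split off from \<open>Q\<close>, the exact identity compares the remaining factor
  \<open>Q'\<close> with \<open>Q'(-t)\<close>. Coprimality makes \<open>Q'\<close> even, and the identity then says that the odd part of
  \<open>S/(t\<^sup>n Q)\<close> is \<open>R\<close>. Its even part is the approximation of \<open>\<Lambda>(t\<^sup>2)\<close> sought.
\<close>

lemma approx_descent:
  assumes approx: "approx n Q S" and "lead_coeff Q = 1" and bezout: "u * S + v * Q = 1"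
    and Q0: "poly Q 0 \<noteq> 0" and S0: "n = 0 \<or> poly S 0 \<noteq> 0"
  shows "\<exists>W S'. approx (n div 2) W S' \<and> degree W < degree Q"
proof -
  let ?T = "monom 1 N + 1 :: 'a poly"
  let ?L = "laurent_of_poly :: 'a poly \<Rightarrow> 'a fls"
  have T: "?T \<noteq> 0" "degree ?T = N"
    using degree_monom_one_add[of N 1] M_pos N_eq by (simp_all flip: one_pCons)
  have minusT: "at_minus ?T = ?T"
    unfolding at_square_star_poly[symmetric] by (rule at_minus_at_square)
  note id = approx_identity[OF approx]
  obtain Q' where Q': "Q = ?T * Q'"
    using star_denominator[OF id frob_fixed[OF assms(1-3)]] .
  have nz: "Q' \<noteq> 0" "poly Q' 0 \<noteq> 0"
    using Q0 by (auto simp: Q')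
  have "?T * ?T * (of_nat N * monom 1 (N - 1 + n) * Q' * at_minus Q')
    = ?T * ?T * (at_minus Q' * S - (-1) ^ n * Q' * at_minus S)"
    using id unfolding Q' pcompose_mult minusT by (simp only: algebra_simps)
  then have id': "of_nat N * monom 1 (N - 1 + n) * Q' * at_minus Q'
    = at_minus Q' * S - (-1) ^ n * Q' * at_minus S"
    using T by (metis mult_cancel_left no_zero_divisors)
  have even: "at_minus Q' = Q'"
  proof -
    have "at_minus Q' = u * (at_minus Q' * S) + v * ?T * Q' * at_minus Q'"
      using bezout unfolding Q' by algebra
    also have "\<dots> = Q' * (u * (of_nat N * monom 1 (N - 1 + n) * at_minus Q' + (-1) ^ n * at_minus S)
        + v * ?T * at_minus Q')"
    proof -
      have "at_minus Q' * S = of_nat N * monom 1 (N - 1 + n) * Q' * at_minus Q' + (-1) ^ n * Q' * at_minus S"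
        unfolding id' by simp
      then show ?thesis by (simp only:) (simp add: algebra_simps)
    qed
    finally obtain k where k: "at_minus Q' = Q' * k"
      by blast
    have "degree (at_minus Q') = degree Q'" "at_minus Q' \<noteq> 0"
      using nz by (simp_all add: degree_pcompose pcompose_eq_0_iff)
    then have "degree k = 0"
      unfolding k using nz by (auto simp: degree_mult_eq)
    then obtain c where c: "k = [:c:]"
      by (rule degree_eq_zeroE)
    have "poly Q' 0 = poly (at_minus Q') 0"
      by (simp add: poly_pcompose)
    then have "c = 1"
      using nz by (simp add: k c)
    then show ?thesis by (simp add: k c flip: one_pCons)
  qed
  have "Q' * (S - (-1) ^ n * at_minus S) = Q' * (of_nat N * monom 1 (N - 1 + n) * Q')"
    using id' unfolding even by (simp only: algebra_simps)
  then have odd_part: "S - (-1) ^ n * at_minus S = of_nat N * monom 1 (N - 1 + n) * Q'"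
    using nz by simp
  \<comment> \<open>For odd \<open>n\<close>, the identity at \<open>t = 0\<close> reads \<open>2 S(0) = 0\<close>.\<close>
  have "even n"
  proof (rule ccontr)
    assume "odd n"
    have "poly (S - (-1) ^ n * at_minus S) 0 = 0"
      unfolding odd_part using M_pos by (simp add: N_eq poly_monom power_0_left)
    with \<open>odd n\<close> have "2 * poly S 0 = 0"
      by (simp add: poly_pcompose)
    with two_neq_0 S0 \<open>odd n\<close> show False
      by auto
  qed
  obtain U V where UV: "Q' = at_square U + monom 1 1 * at_square V"
    by (rule parity_decomposition[of Q' UNIV]) auto
  have "at_minus Q' = at_square U - monom 1 1 * at_square V"
    unfolding UV by (simp only: pcompose_add pcompose_mult at_minus_at_square at_minus_X) simp
  then have "2 * (monom 1 1 * at_square V) = 0"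
    using even UV by algebra
  then have Q'U: "Q' = at_square U"
    using UV by (simp only: two_mult_eq_0_iff) simp
  define W where "W = star_poly * U"
  have QW: "Q = at_square W"
    by (simp add: W_def pcompose_mult at_square_star_poly Q' Q'U)
  obtain Se So where S: "S = at_square Se + monom 1 1 * at_square So"
    by (rule parity_decomposition[of S UNIV]) auto
  have So: "monom 1 1 * at_square So = of_nat M * monom 1 (N - 1 + n) * Q'"
  proof -
    have "at_minus S = at_square Se - monom 1 1 * at_square So"
      unfolding S by (simp only: pcompose_add pcompose_mult at_minus_at_square at_minus_X) simp
    then have "2 * (monom 1 1 * at_square So) = S - at_minus S"
      using S by algebra
    also have "\<dots> = 2 * (of_nat M * monom 1 (N - 1 + n) * Q')"
      using odd_part \<open>even n\<close> by (simp add: N_eq algebra_simps)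
    finally have "2 * (monom 1 1 * at_square So - of_nat M * monom 1 (N - 1 + n) * Q') = 0"
      by (simp only: right_diff_distrib) simp
    then show ?thesis
      by (simp only: two_mult_eq_0_iff) simp
  qed
  define \<Gamma> where "\<Gamma> = ?L (monom 1 (n div 2) * W) * \<Lambda> - ?L Se"
  have deg2: "degree (monom 1 2 :: 'a poly) = 2"
    by (simp add: degree_monom_eq)
  then have deg: "degree (monom 1 2 :: 'a poly) \<ge> 1"
    by simp
  have "laurent_subst \<Gamma> (monom 1 2) = ?L (monom 1 n * Q) * (\<Lambda> - R 0) - ?L (at_square Se)"
    using \<open>even n\<close>
    by (simp add: \<Gamma>_def laurent_subst_diff[OF deg] laurent_subst_mult[OF deg] Lambda_square
        laurent_subst_laurent_of_poly[OF deg] pcompose_mult QW monom_pcompose monom_power)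
  also have "?L (monom 1 n * Q) * (\<Lambda> - R 0)
    = ?L (monom 1 n * Q) * \<Lambda> - ?L (monom 1 n * Q') * (?L ?T * R 0)"
    unfolding Q' laurent_of_poly_mult by algebra
  also have "?L (monom 1 n * Q') * (?L ?T * R 0) = ?L (of_nat M * monom 1 (N - 1 + n) * Q')"
  proof -
    have "monom 1 (N - 1 + n) = monom 1 (N - 1) * (monom 1 n :: 'a poly)"
      by (simp add: mult_monom)
    then show ?thesis
      unfolding denominator_times_R0 laurent_of_poly_mult[symmetric] by (simp only: mult_ac)
  qed
  also have "?L (monom 1 n * Q) * \<Lambda> - ?L (of_nat M * monom 1 (N - 1 + n) * Q') - ?L (at_square Se)
    = ?L (monom 1 n * Q) * \<Lambda> - ?L S"
    unfolding S laurent_of_poly_add So by simp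
  finally have subst: "laurent_subst \<Gamma> (monom 1 2) = ?L (monom 1 n * Q) * \<Lambda> - ?L S" .
  have degQ: "degree Q = 2 * degree W"
    by (simp add: QW degree_pcompose deg2)
  have "2 * defect W \<le> defect Q"
    unfolding QW by (rule defect_at_square) (simp add: W_def)
  then have "vanishes_upto (int 2 * int (degree W + 2 * defect W)) (laurent_subst \<Gamma> (monom 1 2))"
    unfolding subst using approx by (auto simp: approx_def degQ elim: vanishes_upto_mono)
  then have "vanishes_upto (int (degree W + 2 * defect W)) \<Gamma>"
    using vanishes_upto_laurent_subst[OF deg] by (simp only: deg2)
  moreover have "W \<noteq> 0"
    using Q0 by (auto simp: QW)
  ultimately have "approx (n div 2) W Se"
    by (simp add: approx_def \<Gamma>_def)
  moreover have "N \<le> degree Q"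
    unfolding Q' using T nz by (simp add: degree_mult_eq)
  ultimately show ?thesis
    using degQ M_pos N_eq by (intro exI[of _ W] exI[of _ Se]) simp
qed

text \<open>
  A good approximation that minimises \<open>n + 2 deg Q\<close> satisfies all the hypotheses of the descent:
  otherwise a factor could be cancelled, or a factor \<open>t\<close> moved from \<open>Q\<close> into \<open>t\<^sup>n\<close>. The weight \<open>2\<close> makes
  that last move a decrease.
\<close>

lemma no_approx: "\<not> approx n Q S"
proof (induction "n + 2 * degree Q" arbitrary: n Q S rule: less_induct)
  case less
  show ?case
  proof
    assume approx: "approx n Q S"
    have minimal: "n + 2 * degree Q \<le> n' + 2 * degree Q'" if "approx n' Q' S'" for n' Q' S'
      using less[of n' Q' S'] that by force
    have nz: "Q \<noteq> 0"
      using approx by (rule approx_nonzero)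
    have Q0: "poly Q 0 \<noteq> 0"
    proof
      assume "poly Q 0 = 0"
      then obtain A where A: "Q = monom 1 1 * A"
        by (auto simp: poly_eq_0_iff_dvd monom_altdef elim: dvdE)
      with approx have "approx (Suc n) A S"
        using approx_shift by blast
      then show False
        using minimal[of "Suc n" A S] nz by (auto simp: A degree_mult_eq degree_monom_eq)
    qed
    have S0: "n = 0 \<or> poly S 0 \<noteq> 0"
    proof (rule ccontr)
      assume *: "\<not> (n = 0 \<or> poly S 0 \<noteq> 0)"
      then obtain A where "S = monom 1 1 * A"
        by (auto simp: poly_eq_0_iff_dvd monom_altdef elim: dvdE)
      moreover obtain n' where n': "n = Suc n'"
        using * by (cases n) auto
      ultimately have "approx n' Q A"
        using approx approx_unshift by blast
      then show False
        using minimal[of n' Q A] n' by simp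
    qed
    obtain g S' Q' u v where g: "S = g * S'" "Q = g * Q'" "u * S' + v * Q' = 1"
      using bezout_cofactors[of S Q] by blast
    have "approx n Q' S'"
      using approx unfolding g by (rule approx_cancel)
    then have "degree Q \<le> degree Q'"
      using minimal[of n Q' S'] by simp
    then have "degree g = 0"
      using nz by (auto simp: g degree_mult_eq)
    then obtain c where c: "g = [:c:]"
      by (rule degree_eq_zeroE)
    define l where "l = lead_coeff Q'"
    have l: "l \<noteq> 0"
      using nz by (auto simp: g l_def)
    have "\<exists>W S''. approx (n div 2) W S'' \<and> degree W < degree (smult (inverse l) Q')"
    proof (rule approx_descent)
      show "approx n (smult (inverse l) Q') (smult (inverse l) S')"
        using \<open>approx n Q' S'\<close> l by (intro approx_scale) auto
      show "lead_coeff (smult (inverse l) Q') = 1"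
        using l by (simp add: l_def)
      show "smult l u * smult (inverse l) S' + smult l v * smult (inverse l) Q' = 1"
        using g(3) l by simp
      show "poly (smult (inverse l) Q') 0 \<noteq> 0" "n = 0 \<or> poly (smult (inverse l) S') 0 \<noteq> 0"
        using Q0 S0 l by (auto simp: g)
    qed
    then obtain W S'' where "approx (n div 2) W S''" "degree W < degree Q'"
      using l by auto
    moreover have "degree Q' = degree Q"
      using nz by (auto simp: g c)
    ultimately show False
      using minimal[of "n div 2" W S''] by simp
  qed
qed

lemma Lambda_badly_approximable:
  assumes "Q \<noteq> 0"
  shows "\<not> vanishes_upto (int (degree Q + 2 * N))
    (laurent_of_poly (monom 1 n * Q) * \<Lambda> - laurent_of_poly S)"
proof
  assume "vanishes_upto (int (degree Q + 2 * N))
    (laurent_of_poly (monom 1 n * Q) * \<Lambda> - laurent_of_poly S)"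
  then have "approx n Q S"
    using assms defect_le[of Q] by (auto simp: approx_def elim: vanishes_upto_mono)
  with no_approx show False by blast
qed

end

section \<open>From \<open>t\<close> to \<open>P(t)\<close>\<close>

lemma base_expansion:
  fixes P Q :: "'a::field poly"
  assumes "degree P \<ge> 1"
  shows "\<exists>q. Q = (\<Sum>i<degree P. monom 1 i * pcompose (q i) P)"
proof (induction "degree Q" arbitrary: Q rule: less_induct)
  case less
  have small: "\<exists>q. A = (\<Sum>i<degree P. monom 1 i * [:q i:])" if "degree A < degree P" for A :: "'a poly"
  proof
    have "A = (\<Sum>i\<le>degree P - 1. monom (coeff A i) i)"
      using that by (intro poly_as_sum_of_monoms'[symmetric]) auto
    also have "{..degree P - 1} = {..<degree P}"
      using assms by auto
    finally show "A = (\<Sum>i<degree P. monom 1 i * [:coeff A i:])"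
      by (simp add: smult_monom)
  qed
  have mod: "degree (Q mod P) < degree P"
    using assms degree_mod_less[of P Q] by (cases "P = 0") auto
  then obtain c where c: "Q mod P = (\<Sum>i<degree P. monom 1 i * [:c i:])"
    using small by blast
  obtain q where q: "Q div P = (\<Sum>i<degree P. monom 1 i * pcompose (q i) P)"
  proof (cases "degree Q < degree P")
    case True
    then have "Q div P = (\<Sum>i<degree P. monom 1 i * pcompose 0 P)"
      by (simp add: div_poly_less)
    then show ?thesis using that[of "\<lambda>_. 0"] by simp
  next
    case False
    have "degree (Q div P) < degree Q"
      using assms False by (intro degree_div_less) auto
    then show ?thesis using less that by blast
  qed
  have "Q = P * (Q div P) + Q mod P"
    by simp
  also have "\<dots> = (\<Sum>i<degree P. monom 1 i * pcompose (pCons (c i) (q i)) P)"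
    unfolding c q sum_distrib_left sum.distrib[symmetric] pcompose_pCons
    by (simp only: algebra_simps)
  finally show ?case
    by (intro exI[of _ "\<lambda>i. pCons (c i) (q i)"])
qed

lemma vanishes_upto_sum_distinct_subdegrees:
  fixes f :: "'b \<Rightarrow> 'a::ab_group_add fls"
  assumes "finite I" and distinct: "\<And>i j. i \<in> I \<Longrightarrow> j \<in> I \<Longrightarrow> f i \<noteq> 0 \<Longrightarrow> f j \<noteq> 0 \<Longrightarrow>
      fls_subdegree (f i) = fls_subdegree (f j) \<Longrightarrow> i = j"
    and van: "vanishes_upto k (\<Sum>i\<in>I. f i)" and "j \<in> I"
  shows "vanishes_upto k (f j)"
proof (rule ccontr)
  assume *: "\<not> vanishes_upto k (f j)"
  define J where "J = {i\<in>I. f i \<noteq> 0}"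
  have "finite J" "j \<in> J"
    using * assms by (auto simp: J_def)
  then obtain i where i: "i \<in> J" "\<And>l. l \<in> J \<Longrightarrow> fls_subdegree (f i) \<le> fls_subdegree (f l)"
    using arg_min_if_finite[of J "\<lambda>l. fls_subdegree (f l)"] by (metis empty_iff not_le)
  let ?s = "fls_subdegree (f i)"
  have "fls_nth (f l) ?s = 0" if "l \<in> I" "l \<noteq> i" for l
  proof (cases "f l = 0")
    case False
    then have "?s \<le> fls_subdegree (f l)" "?s \<noteq> fls_subdegree (f l)"
      using i distinct[of i l] that by (auto simp: J_def)
    then show ?thesis by simp
  qed simp
  then have "fls_nth (\<Sum>l\<in>I. f l) ?s = (\<Sum>l\<in>{i}. fls_nth (f l) ?s)"
    unfolding fls_nth_sum using i \<open>finite I\<close> by (intro sum.mono_neutral_right) (auto simp: J_def)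
  also have "\<dots> \<noteq> 0"
    using i by (simp add: J_def)
  finally have "\<not> ?s \<le> k"
    using van by (auto simp: vanishes_upto_def)
  moreover have "?s \<le> fls_subdegree (f j)"
    using i \<open>j \<in> J\<close> by blast
  ultimately show False
    using * by (simp add: vanishes_upto_iff)
qed

text \<open>
  The nonzero terms have degrees congruent to \<open>i\<close> modulo \<open>deg P\<close>, so they cannot cancel.
\<close>

lemma vanishes_upto_base_expansion:
  fixes P :: "'a::field poly"
  assumes P: "degree P \<ge> 1"
    and "vanishes_upto k (\<Sum>i<degree P. laurent_of_poly (monom 1 i) * laurent_subst (G i) P)"
    and "j < degree P"
  shows "vanishes_upto k (laurent_of_poly (monom 1 j) * laurent_subst (G j) P)"
proof (rule vanishes_upto_sum_distinct_subdegrees[OF _ _ assms(2)])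
  let ?d = "int (degree P)"
  let ?f = "\<lambda>i. laurent_of_poly (monom 1 i) * laurent_subst (G i) P"
  fix i l assume il: "i \<in> {..<degree P}" "l \<in> {..<degree P}" "?f i \<noteq> 0" "?f l \<noteq> 0"
    "fls_subdegree (?f i) = fls_subdegree (?f l)"
  have "fls_subdegree (?f i) = ?d * fls_subdegree (G i) - int i" if "?f i \<noteq> 0" for i
    using that by (simp add: fls_subdegree_laurent_of_poly fls_subdegree_laurent_subst[OF P] degree_monom_eq)
  then have "?d * fls_subdegree (G i) - int i = ?d * fls_subdegree (G l) - int l"
    using il by metis
  then have "int i - int l = ?d * (fls_subdegree (G i) - fls_subdegree (G l))"
    by (simp add: algebra_simps)
  then have "?d dvd int i - int l"
    by simp
  then show "i = l"
    using il by (metis lessThan_iff mod_eq_dvd_iff mod_less of_nat_eq_iff of_nat_mod)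
qed (use assms in auto)

context odd_characteristic
begin

text \<open>
  The fractional part of \<open>P\<^sup>v Q \<Lambda>(P)\<close> is \<open>\<Sum>\<^sub>i t\<^sup>i G\<^sub>i(P)\<close>, where \<open>G\<^sub>i\<close> is the fractional part of \<open>t\<^sup>v q\<^sub>i \<Lambda>\<close>. It
  suffices to look at one index \<open>j\<close> with \<open>q\<^sub>j \<noteq> 0\<close>, since both \<open>deg Q\<close> and the degree of the fractional
  part are bounded below by those of their \<open>j\<close>-th terms.
\<close>

lemma subst_Lambda_badly_approximable:
  assumes P: "degree P \<ge> 1" and "Q \<noteq> 0"
  shows "\<not> vanishes_upto (int (degree Q + 2 * N * degree P))
    (laurent_frac (laurent_of_poly (P ^ v * Q) * laurent_subst \<Lambda> P))"
proof
  let ?L = "laurent_of_poly :: 'a poly \<Rightarrow> 'a fls"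
  let ?d = "degree P"
  obtain q where q: "Q = (\<Sum>i<?d. monom 1 i * pcompose (q i) P)"
    using base_expansion[OF P] by blast
  then obtain j where j: "j < ?d" "q j \<noteq> 0"
    using \<open>Q \<noteq> 0\<close> by (metis (no_types, lifting) lessThan_iff mult_zero_right pcompose_0 sum.neutral)
  have "\<forall>i. \<exists>S. vanishes_upto 0 (?L (monom 1 v * q i) * \<Lambda> - ?L S)"
    by (intro allI polynomial_part_exists)
  then obtain S where S: "\<And>i. vanishes_upto 0 (?L (monom 1 v * q i) * \<Lambda> - ?L (S i))"
    by metis
  define G where "G i = ?L (monom 1 v * q i) * \<Lambda> - ?L (S i)" for i
  define A where "A = (\<Sum>i<?d. monom 1 i * pcompose (S i) P)"
  have subst: "laurent_subst (G i) P = ?L (P ^ v * pcompose (q i) P) * laurent_subst \<Lambda> P - ?L (pcompose (S i) P)" for i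
    by (simp add: G_def laurent_subst_diff[OF P] laurent_subst_mult[OF P]
        laurent_subst_laurent_of_poly[OF P] pcompose_mult monom_pcompose)
  have expand: "?L (P ^ v * Q) * laurent_subst \<Lambda> P - ?L A
    = (\<Sum>i<?d. ?L (monom 1 i) * laurent_subst (G i) P)"
    unfolding subst q A_def laurent_of_poly_sum laurent_of_poly_mult sum_distrib_left sum_distrib_right
      sum_subtractf[symmetric]
    by (simp only: algebra_simps)
  have "vanishes_upto 0 (?L (monom 1 i) * laurent_subst (G i) P)" if "i < ?d" for i
  proof -
    have "laurent_subst (G i) P = 0 \<or> int i < fls_subdegree (laurent_subst (G i) P)"
    proof (cases "G i = 0")
      case False
      then have "1 \<le> fls_subdegree (G i)"
        using S[of i] by (auto simp: G_def[symmetric] vanishes_upto_iff)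
      then have "int ?d * 1 \<le> int ?d * fls_subdegree (G i)"
        by (intro mult_left_mono) auto
      with that have "int i < int ?d * fls_subdegree (G i)"
        by linarith
      then show ?thesis
        by (simp add: fls_subdegree_laurent_subst[OF P])
    qed (simp add: laurent_subst_0[OF P])
    then show ?thesis
      by (subst vanishes_upto_mult_poly) (auto simp: vanishes_upto_iff degree_monom_eq)
  qed
  then have "vanishes_upto 0 (?L (P ^ v * Q) * laurent_subst \<Lambda> P - ?L A)"
    unfolding expand by (intro vanishes_upto_sum) auto
  then have frac: "laurent_frac (?L (P ^ v * Q) * laurent_subst \<Lambda> P)
    = (\<Sum>i<?d. ?L (monom 1 i) * laurent_subst (G i) P)"
    unfolding expand[symmetric] by (rule laurent_frac_eqI)
  assume "vanishes_upto (int (degree Q + 2 * N * ?d))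
    (laurent_frac (?L (P ^ v * Q) * laurent_subst \<Lambda> P))"
  then have "vanishes_upto (int (degree Q + 2 * N * ?d)) (?L (monom 1 j) * laurent_subst (G j) P)"
    unfolding frac by (rule vanishes_upto_base_expansion[OF P _ j(1)])
  then have van: "vanishes_upto (int (degree Q + 2 * N * ?d) + int j) (laurent_subst (G j) P)"
    by (subst (asm) vanishes_upto_mult_poly) (auto simp: degree_monom_eq)
  have "int j + int ?d * int (degree (q j)) \<le> int (degree Q)"
  proof -
    have "?L Q = (\<Sum>i<?d. ?L (monom 1 i) * laurent_subst (?L (q i)) P)"
      by (subst q) (simp add: laurent_of_poly_sum laurent_of_poly_mult laurent_subst_laurent_of_poly[OF P])
    moreover have "vanishes_upto (- int (degree Q) - 1) (?L Q)"
      by (simp add: vanishes_upto_iff fls_subdegree_laurent_of_poly)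
    ultimately have "vanishes_upto (- int (degree Q) - 1) (?L (monom 1 j) * laurent_subst (?L (q j)) P)"
      using vanishes_upto_base_expansion[OF P _ j(1), of _ "\<lambda>i. ?L (q i)"] by simp
    then show ?thesis
      using j by (simp add: vanishes_upto_iff laurent_subst_eq_0_iff[OF P] fls_subdegree_laurent_subst[OF P]
          fls_subdegree_laurent_of_poly degree_monom_eq)
  qed
  then have "int ?d * int (degree (q j) + 2 * N) \<le> int (degree Q + 2 * N * ?d) + int j"
    by (simp add: algebra_simps)
  with van have "vanishes_upto (int ?d * int (degree (q j) + 2 * N)) (laurent_subst (G j) P)"
    by (rule vanishes_upto_mono)
  then have "vanishes_upto (int (degree (q j) + 2 * N)) (G j)"
    by (simp only: vanishes_upto_laurent_subst[OF P])
  then show False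
    using Lambda_badly_approximable[OF j(2)] by (simp add: G_def)
qed

end

text \<open>
  The exponents \<open>v\<close> with \<open>P\<^sup>v dvd Q\<close> are bounded by \<open>deg Q\<close>, so the maximum in the definition is attained.
\<close>

lemma adic_val_dvd:
  assumes "degree P \<ge> 1" "Q \<noteq> 0"
  shows "P ^ adic_val P Q dvd Q"
  unfolding adic_val_def
proof (rule GreatestI_nat)
  show "P ^ 0 dvd Q" by simp
  show "v \<le> degree Q" if "P ^ v dvd Q" for v
  proof -
    have "v * 1 \<le> v * degree P"
      using assms by (intro mult_left_mono) auto
    also have "\<dots> = degree (P ^ v)"
      using assms by (subst degree_power_eq) auto
    also have "\<dots> \<le> degree Q"
      using that assms by (intro dvd_imp_degree_le)
    finally show ?thesis by simp
  qed
qed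

lemma degree_irreducible:
  fixes P :: "'a::field poly"
  assumes "irreducible P"
  shows "degree P \<ge> 1"
  using assms is_unit_iff_degree[of P] by (cases "P = 0") (auto simp: irreducible_def Suc_le_eq)

theorem theorem1p2:
  fixes P :: "'a::field poly" and p r :: nat
  assumes "p = CHAR('a)" and "odd p"
    and "irreducible P"
    and "r = multiplicity 2 (p - 1)"
  shows "littlewood_inf P (laurent_subst (Lambda r) P) \<ge> 2 powi (- int (2 ^ (r + 1) * degree P))
         \<and> littlewood_counterexample P (laurent_subst (Lambda r) P)"
proof -
  interpret odd_characteristic "TYPE('a)" p r "2 ^ r"
    using assms by unfold_locales auto
  have P: "degree P \<ge> 1"
    using assms by (intro degree_irreducible)
  then have "P \<noteq> 0" by auto
  let ?\<Gamma> = "laurent_subst (Lambda r) P"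
  let ?c = "2 powi (- int (2 ^ (r + 1) * degree P)) :: real"
  have "?c \<le> littlewood_inf P ?\<Gamma>"
    unfolding littlewood_inf_def
  proof (rule cINF_greatest)
    show "UNIV - {0 :: 'a poly} \<noteq> {}"
      using \<open>P \<noteq> 0\<close> by auto
    fix Q :: "'a poly"
    assume "Q \<in> UNIV - {0}"
    then have "Q \<noteq> 0" by simp
    define v where "v = adic_val P Q"
    obtain Q0 where Q0: "Q = P ^ v * Q0"
      using adic_val_dvd[OF P \<open>Q \<noteq> 0\<close>] unfolding v_def by (rule dvdE)
    define F where "F = laurent_frac (laurent_of_poly Q * ?\<Gamma>)"
    have "Q0 \<noteq> 0"
      using \<open>Q \<noteq> 0\<close> Q0 by auto
    then have "\<not> vanishes_upto (int (degree Q0 + 2 * 2 ^ r * degree P)) F"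
      unfolding F_def Q0 by (rule subst_Lambda_badly_approximable[OF P])
    then have F: "F \<noteq> 0" "fls_subdegree F \<le> int (degree Q0 + 2 * 2 ^ r * degree P)"
      by (auto simp: vanishes_upto_iff)
    have degQ: "degree Q = v * degree P + degree Q0"
      using \<open>Q0 \<noteq> 0\<close> \<open>P \<noteq> 0\<close> by (simp add: Q0 degree_mult_eq degree_power_eq)
    have "laurent_abs (laurent_of_poly Q) * adic_abs P Q * laurent_abs F
      = 2 powi int (degree Q) * (2 powi int (degree P)) powi (- int v) * 2 powi (- fls_subdegree F)"
      using F \<open>Q \<noteq> 0\<close> \<open>P \<noteq> 0\<close>
      by (simp add: laurent_abs_def adic_abs_def laurent_deg_laurent_of_poly v_def laurent_deg_def
          fls_subdegree_laurent_of_poly)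
    also have "\<dots> = 2 powi (int (degree Q) + int (degree P) * (- int v) + (- fls_subdegree F))"
      by (simp only: power_int_add[of "2 :: real", simplified] power_int_mult[symmetric])
    also have "\<dots> \<ge> ?c"
      using F(2) by (intro power_int_increasing) (simp_all add: degQ algebra_simps)
    finally show "?c \<le> laurent_abs (laurent_of_poly Q) * adic_abs P Q * laurent_abs (laurent_frac (laurent_of_poly Q * ?\<Gamma>))"
      by (simp add: F_def)
  qed
  moreover have "?c > 0"
    by simp
  ultimately show ?thesis
    unfolding littlewood_counterexample_def by linarith
qed

end
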